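(* Let $Q(T_1,\dots,T_\ell)$ be a polynomial with nonnegative real coefficients. Let $g_1,\dots,g_\ell$ be nonnegative strongly additive functions such that: (a) for each $j$ there is a constant $G_j$ with $g_j(p)\le G_j$ for all primes $p$; (b) for each $1\le j\le\ell$ the series $\sum_p g_j(p)^2/p$ diverges; (c) for all $1\le i,j\le\ell$ one has $\sigma^2(g_i)\gg\mu(g_j)$ for all sufficiently large $x$ (i.e. there is $c>0$ with $\sigma^2(g_i)\ge c\,\mu(g_j)$ for all large $x$). Define $$A_Q(x)=Q\big(\mu(g_1),\dots,\mu(g_\ell)\big),\qquad B_Q(x)^2=\sum_{i=1}^\ell\sum_{j=1}^\ell \frac{\partial Q}{\partial T_i}\big(\mu(g_1),\dots,\mu(g_\ell)\big)\frac{\partial Q}{\partial T_j}\big(\mu(g_1),\dots,\mu(g_\ell)\big)\kappa(g_i,g_j),$$ with $B_Q(x)\ge0$. Then for every real $u$, $$\lim_{x\to\infty}\frac1x\#\big\{n\le x: Q(g_1(n),\dots,g_\ell(n))<A_Q(x)+uB_Q(x)\big\}=\frac1{\sqrt{2\pi}}\int_{-\infty}^u e^{-t^2/2}\,dt.$$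
   Context: A function $g:\mathbb N\to\mathbb R$ is additive if $g(mn)=g(m)+g(n)$ whenever $\gcd(m,n)=1$, and strongly additive if moreover $g(p^\alpha)=g(p)$ for all primes $p$ and integers $\alpha\ge1$ (so $g(n)=\sum_{p\mid n}g(p)$). All quantities below depend on a real parameter $x$: $\mu(g)=\sum_{p\le x}\frac{g(p)}{p}$, $\kappa(g_i,g_j)=\sum_{p\le x}\frac{g_i(p)g_j(p)}{p}\big(1-\frac1p\big)$, $\sigma^2(g)=\kappa(g,g)$, sums over primes $p$.
   Formalization: The polynomial Q is additionally assumed to be non-constant; for constant Q one has B_Q = 0 and the count is 0 for every u, so the stated limit fails. *)

theory Defs
  imports "HOL-Analysis.Analysis" "HOL-Computational_Algebra.Primes"
begin

definition additive :: "(nat \<Rightarrow> real) \<Rightarrow> bool" where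
  "additive g \<longleftrightarrow> (\<forall>m n. coprime m n \<longrightarrow> g (m * n) = g m + g n)"

definition strongly_additive :: "(nat \<Rightarrow> real) \<Rightarrow> bool" where
  "strongly_additive g \<longleftrightarrow> additive g \<and>
     (\<forall>p a. prime p \<and> a \<ge> 1 \<longrightarrow> g (p ^ a) = g p)"

definition mu :: "(nat \<Rightarrow> real) \<Rightarrow> real \<Rightarrow> real" where
  "mu g x = (\<Sum>p\<in>{p. prime p \<and> real p \<le> x}. g p / real p)"

definition kappa :: "(nat \<Rightarrow> real) \<Rightarrow> (nat \<Rightarrow> real) \<Rightarrow> real \<Rightarrow> real" where
  "kappa gi gj x = (\<Sum>p\<in>{p. prime p \<and> real p \<le> x}.
       gi p * gj p / real p * (1 - 1 / real p))"

definition sigma2 :: "(nat \<Rightarrow> real) \<Rightarrow> real \<Rightarrow> real" where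
  "sigma2 g x = kappa g g x"

text \<open>A polynomial in the variables T_0,...,T_(l-1) is represented by its coefficient
  function Q on exponent vectors (alpha i = exponent of T_i); it must have finite support.\<close>

definition mpoly_eval :: "nat \<Rightarrow> ((nat \<Rightarrow> nat) \<Rightarrow> real) \<Rightarrow> (nat \<Rightarrow> real) \<Rightarrow> real" where
  "mpoly_eval l Q t = (\<Sum>\<alpha>\<in>{\<alpha>. Q \<alpha> \<noteq> 0}. Q \<alpha> * (\<Prod>i<l. t i ^ \<alpha> i))"

definition mpoly_deriv_eval :: "nat \<Rightarrow> ((nat \<Rightarrow> nat) \<Rightarrow> real) \<Rightarrow> nat \<Rightarrow> (nat \<Rightarrow> real) \<Rightarrow> real" where
  "mpoly_deriv_eval l Q k t = (\<Sum>\<alpha>\<in>{\<alpha>. Q \<alpha> \<noteq> 0}.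
      Q \<alpha> * real (\<alpha> k) * t k ^ (\<alpha> k - 1) * (\<Prod>i\<in>{..<l} - {k}. t i ^ \<alpha> i))"

definition A_Q :: "nat \<Rightarrow> ((nat \<Rightarrow> nat) \<Rightarrow> real) \<Rightarrow> (nat \<Rightarrow> nat \<Rightarrow> real) \<Rightarrow> real \<Rightarrow> real" where
  "A_Q l Q g x = mpoly_eval l Q (\<lambda>i. mu (g i) x)"

definition B_Q :: "nat \<Rightarrow> ((nat \<Rightarrow> nat) \<Rightarrow> real) \<Rightarrow> (nat \<Rightarrow> nat \<Rightarrow> real) \<Rightarrow> real \<Rightarrow> real" where
  "B_Q l Q g x = sqrt (\<Sum>i<l. \<Sum>j<l.
      mpoly_deriv_eval l Q i (\<lambda>k. mu (g k) x) * mpoly_deriv_eval l Q j (\<lambda>k. mu (g k) x)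
      * kappa (g i) (g j) x)"

end

(* The law of Q(g_1(n),...,g_l(n)) is that of its linear part at the point of means: by (c) all the
   mu(g_j) and sigma(g_j)^2 are of the same order v, which tends to infinity, so by the
   Turan-Kubilius inequality the g_j(n) are typically within O(sqrt v) of their means, and the
   second order terms of Q are O(1 / sqrt v) relative to B_Q (nonnegativity of the coefficients
   prevents cancellation). The linear part divided by B_Q is a strongly additive function h whose
   values at primes are O(1 / sqrt v) and whose variance is 1. It depends on x, so an Erdos-Kac
   theorem for triangular arrays is needed. Its characteristic function is computed after
   discarding the primes p > N^(1/2^k): the average over n <= N of a multiplicative function
   supported on the small primes agrees with an Euler product up to a Rankin type error
   2^(-2^k) exp(O(mu(h))), and this product is the characteristic function of a sum of independent
   bounded variables, hence close to exp(-t^2/2). The discarded primes have sum of 1/p at most 2k,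
   so they contribute O(k / sqrt v), and k can be taken of order v^(1/4). Levy's continuity theorem
   concludes. *)

theory Submission
  imports Defs "HOL-Probability.Probability" "HOL-Real_Asymp.Real_Asymp"
begin

section \<open>Mean values over the integers up to \<open>N\<close>\<close>

text \<open>After normalization the variance of h is 1, but its mean is of order sqrt v and
  unbounded. The Rankin error therefore carries a factor exp(O(sqrt v)), and a fixed cutoff N^(1/k)
  cannot absorb it. Halving the exponent of the cutoff adds at most 2 to the sum of 1/p over the
  discarded primes, while it squares the gain 2^(2^k). A loss linear in k against a doubly
  exponential gain leaves a wide range for k, so crude constants and no asymptotics for primes
  suffice. The scale v may grow far more slowly than log log N, since the g_j may live on a sparse
  set of primes. Hence every error is measured in the size \<epsilon> of the values of h, of order 1
  / sqrt v, and never in N. For the same reason the central estimate is an explicit inequality for a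
  single N and a single h, so that h may change freely with N.\<close>

lemma card_dvd_atLeastAtMost:
  fixes d N :: nat
  assumes "d > 0"
  shows "card {n \<in> {1..N}. d dvd n} = N div d"
proof -
  have "{n \<in> {1..N}. d dvd n} = (\<lambda>k. d * k) ` {1..N div d}"
    using assms by (auto simp: image_iff dvd_def less_eq_div_iff_mult_less_eq mult.commute Suc_le_eq)
  moreover have "inj_on (\<lambda>k. d * k) {1..N div d}"
    using assms by (auto simp: inj_on_def)
  ultimately show ?thesis
    by (simp add: card_image)
qed

lemma sum_dvd_eq:
  fixes c :: "'a :: comm_semiring_1"
  assumes "d > 0"
  shows "(\<Sum>n=1..N. if d dvd n then c else 0) = of_nat (N div d) * c"
proof -
  have "(\<Sum>n=1..N. if d dvd n then c else 0) = (\<Sum>n\<in>{n \<in> {1..N}. d dvd n}. c)"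
    by (intro sum.inter_filter [symmetric]) auto
  thus ?thesis
    using card_dvd_atLeastAtMost[OF assms, of N] by simp
qed

lemma abs_div_diff_le_powr:
  fixes N d :: nat and s :: real
  assumes "N > 0" "d > 0" "0 \<le> s" "s \<le> 1"
  shows "\<bar>real (N div d) / real N - 1 / real d\<bar> \<le> real N powr (-s) * (real d powr s / real d)"
proof -
  \<comment> \<open>The distance from \<open>v\<close> to its floor is at most \<open>min 1 v \<le> v\<^sup>1\<^sup>-\<^sup>s\<close>.\<close>
  define v where "v = real N / real d"
  have v: "v > 0" using assms by (simp add: v_def)
  have fl: "real (N div d) = of_int \<lfloor>v\<rfloor>"
    unfolding v_def by (simp add: floor_divide_of_nat_eq)
  have "\<bar>real (N div d) - v\<bar> \<le> v powr (1 - s)"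
  proof (cases "v \<ge> 1")
    case True
    have "\<bar>real (N div d) - v\<bar> \<le> 1" unfolding fl by linarith
    also have "1 \<le> v powr (1 - s)" using True assms by (simp add: ge_one_powr_ge_zero)
    finally show ?thesis .
  next
    case False
    have "\<bar>real (N div d) - v\<bar> \<le> v"
      using v False by (simp add: fl abs_le_iff)
    also have "v = v powr 1" using v by simp
    also have "\<dots> \<le> v powr (1 - s)" using v False assms by (intro powr_mono') auto
    finally show ?thesis .
  qed
  hence "\<bar>real (N div d) - v\<bar> / real N \<le> v powr (1 - s) / real N"
    using assms by (intro divide_right_mono) auto
  also have "\<bar>real (N div d) - v\<bar> / real N = \<bar>real (N div d) / real N - 1 / real d\<bar>"
    using assms by (subst abs_div_pos) (auto simp: v_def diff_divide_distrib)
  also have "v powr (1 - s) / real N = real N powr (-s) * (real d powr s / real d)"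
    using assms by (simp add: v_def powr_divide powr_diff powr_minus field_simps)
  finally show ?thesis .
qed

lemma prod_primes_dvd_iff:
  fixes D :: "nat set"
  assumes "finite D" "\<And>p. p \<in> D \<Longrightarrow> prime p"
  shows "(\<Prod>D) dvd n \<longleftrightarrow> (\<forall>p\<in>D. p dvd n)"
  using assms
proof (induction D rule: finite_induct)
  case (insert p D)
  have "coprime p (\<Prod>D)"
    using insert by (intro prod_coprime_right) (metis insertCI primes_coprime)
  hence "p * \<Prod>D dvd n \<longleftrightarrow> p dvd n \<and> \<Prod>D dvd n"
    by (meson divides_mult dvd_mult_left dvd_mult_right)
  thus ?case using insert by auto
qed auto

text \<open>Rankin's trick: the error \<open>min (1/N) (1/d)\<close> of counting multiples of \<open>d\<close> is
  at most \<open>N\<^sup>-\<^sup>s d\<^sup>s\<^sup>-\<^sup>1\<close>, which is multiplicative in \<open>d\<close>, so that the total error is an Euler product.\<close>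

lemma mean_multiplicative_approx:
  fixes a :: "nat \<Rightarrow> complex" and s :: real
  assumes P: "finite P" "\<And>p. p \<in> P \<Longrightarrow> prime p" and "N > 0" "0 \<le> s" "s \<le> 1"
  shows "cmod ((\<Sum>n=1..N. \<Prod>p\<in>P. 1 + (if p dvd n then a p else 0)) / of_nat N
               - (\<Prod>p\<in>P. 1 + a p / of_nat p))
         \<le> real N powr (-s) * (\<Prod>p\<in>P. 1 + cmod (a p) * (real p powr s / real p))"
proof -
  have expand: "(\<Prod>p\<in>P. 1 + f p) = (\<Sum>D\<in>Pow P. \<Prod>p\<in>D. f p)" for f :: "nat \<Rightarrow> 'b :: comm_semiring_1"
    using prod_add[OF P(1), of f "\<lambda>_. 1"] by (simp add: add.commute)
  have pos: "p > 0" if "p \<in> P" for p using P(2)[OF that] by (simp add: prime_gt_0_nat)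
  have D: "finite D" "\<And>p. p \<in> D \<Longrightarrow> prime p" "\<Prod>D > 0" if "D \<in> Pow P" for D
    using that P pos finite_subset by (auto intro!: prod_pos)
  \<comment> \<open>The subsets \<open>D\<close> of \<open>P\<close> stand for the squarefree
    integers \<open>\<Prod>D\<close>: expanding the product turns it into a divisor sum, and only
    counts of multiples remain.\<close>
  have "(\<Sum>n=1..N. \<Prod>p\<in>P. 1 + (if p dvd n then a p else 0)) =
        (\<Sum>n=1..N. \<Sum>D\<in>Pow P. if \<Prod>D dvd n then \<Prod>p\<in>D. a p else 0)"
  proof (intro sum.cong refl, unfold expand, intro sum.cong refl)
    fix n D assume "D \<in> Pow P"
    from D[OF this] show "(\<Prod>p\<in>D. if p dvd n then a p else 0) =
      (if \<Prod>D dvd n then \<Prod>p\<in>D. a p else 0)"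
      by (auto simp: prod_primes_dvd_iff intro!: prod.cong prod_zero)
  qed
  also have "\<dots> = (\<Sum>D\<in>Pow P. \<Sum>n=1..N. if \<Prod>D dvd n then \<Prod>p\<in>D. a p else 0)"
    by (rule sum.swap)
  also have "\<dots> = (\<Sum>D\<in>Pow P. of_nat (N div \<Prod>D) * (\<Prod>p\<in>D. a p))"
    by (intro sum.cong refl sum_dvd_eq D)
  finally have "(\<Sum>n=1..N. \<Prod>p\<in>P. 1 + (if p dvd n then a p else 0)) / of_nat N
       - (\<Prod>p\<in>P. 1 + a p / of_nat p) =
       (\<Sum>D\<in>Pow P. of_nat (N div \<Prod>D) * (\<Prod>p\<in>D. a p)) / of_nat N
       - (\<Sum>D\<in>Pow P. (\<Prod>p\<in>D. a p / of_nat p))"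
    by (simp add: expand)
  also have "\<dots> = (\<Sum>D\<in>Pow P. (\<Prod>p\<in>D. a p) *
                  of_real (real (N div \<Prod>D) / real N - 1 / real (\<Prod>D)))"
    unfolding sum_divide_distrib sum_subtractf [symmetric]
    by (intro sum.cong refl) (simp add: prod_dividef algebra_simps)
  also have "cmod \<dots> \<le> (\<Sum>D\<in>Pow P. (\<Prod>p\<in>D. cmod (a p)) *
                  (real N powr (-s) * (real (\<Prod>D) powr s / real (\<Prod>D))))"
  proof (intro sum_norm_le)
    fix D assume "D \<in> Pow P"
    from D[OF this] show "cmod ((\<Prod>p\<in>D. a p) * of_real (real (N div \<Prod>D) / real N - 1 / real (\<Prod>D)))
        \<le> (\<Prod>p\<in>D. cmod (a p)) * (real N powr (-s) * (real (\<Prod>D) powr s / real (\<Prod>D)))"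
      unfolding norm_mult prod_norm norm_of_real
      by (intro mult_left_mono abs_div_diff_le_powr norm_ge_zero assms)
  qed
  also have "\<dots> = real N powr (-s) * (\<Sum>D\<in>Pow P. \<Prod>p\<in>D. cmod (a p) * (real p powr s / real p))"
    unfolding sum_distrib_left
    by (intro sum.cong refl) (simp add: prod.distrib prod_dividef prod_powr_distrib)
  also have "\<dots> = real N powr (-s) * (\<Prod>p\<in>P. 1 + cmod (a p) * (real p powr s / real p))"
    by (simp add: expand)
  finally show ?thesis .
qed

section \<open>Sums of 1/p over the primes between N^(1/2^k) and N\<close>

text \<open>Each \<open>n \<le> Y\<close> has at most one prime factor \<open>p\<close> with \<open>p\<^sup>2 > Y\<close>; averaging over \<open>n \<le> Y\<close>
  gives the bound. Its iteration below replaces Mertens' theorem.\<close>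

lemma sum_inverse_primes_sqrt_le:
  "(\<Sum>p | prime p \<and> p \<le> Y \<and> Y < p\<^sup>2. 1 / real p) \<le> 2"
proof (cases "Y = 0")
  case False
  define S where "S = {p. prime p \<and> p \<le> Y \<and> Y < p\<^sup>2}"
  have fin: "finite S" unfolding S_def by (rule finite_subset[of _ "{..Y}"]) auto
  have pos: "p > 0" if "p \<in> S" for p using that by (auto simp: S_def prime_gt_0_nat)
  have "card S \<le> card {1..Y}"
    by (intro card_mono) (auto simp: S_def Suc_le_eq prime_gt_0_nat)
  hence cS: "card S \<le> Y" by simp
  have one: "(\<Sum>p\<in>S. if p dvd n then 1 else 0) \<le> (1::nat)" if n: "n \<in> {1..Y}" for n
  proof -
    have "p = q" if "p \<in> S" "q \<in> S" "p dvd n" "q dvd n" for p q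
    proof (rule ccontr)
      assume "p \<noteq> q"
      hence "p * q dvd n" using that primes_coprime[of p q] by (auto simp: S_def divides_mult)
      hence le: "p * q \<le> Y" using n dvd_imp_le[of "p * q" n] by auto
      have "min p q * min p q \<le> p * q" by (intro mult_mono) auto
      moreover have "Y < min p q * min p q"
        using that by (auto simp: S_def min_def power2_eq_square)
      ultimately show False using le by linarith
    qed
    hence "card {p \<in> S. p dvd n} \<le> Suc 0"
      using card_le_Suc0_iff_eq[of "{p \<in> S. p dvd n}"] fin by auto
    thus ?thesis using sum.inter_filter[OF fin, of "\<lambda>_. 1::nat" "\<lambda>p. p dvd n"] by simp
  qed
  have "(\<Sum>p\<in>S. Y div p) = (\<Sum>p\<in>S. \<Sum>n=1..Y. if p dvd n then 1 else 0)"
    by (intro sum.cong refl) (use pos sum_dvd_eq[where c = "1::nat" and N = Y] in auto)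
  also have "\<dots> = (\<Sum>n=1..Y. \<Sum>p\<in>S. if p dvd n then 1 else 0)" by (rule sum.swap)
  also have "\<dots> \<le> (\<Sum>n=1..Y. 1)" by (intro sum_mono one)
  finally have "real (\<Sum>p\<in>S. Y div p) \<le> real Y" by (simp del: of_nat_sum)
  \<comment> \<open>Rounding down \<open>Y / p\<close> loses at most 1 per prime, hence at most
    \<open>card S \<le> Y\<close> in total. This doubles the bound \<open>Y\<close> from the double
    count and gives the constant 2.\<close>
  moreover have "(\<Sum>p\<in>S. real Y * (1 / real p)) \<le> (\<Sum>p\<in>S. real (Y div p) + 1)"
  proof (intro sum_mono)
    fix p assume "p \<in> S"
    show "real Y * (1 / real p) \<le> real (Y div p) + 1"
      using floor_divide_of_nat_eq[of Y p, where 'a = real] by simp linarith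
  qed
  ultimately have "real Y * (\<Sum>p\<in>S. 1 / real p) \<le> real Y * 2"
    using cS by (simp add: sum.distrib sum_distrib_left)
  thus ?thesis using False by (simp add: S_def)
qed (auto)

text \<open>With \<open>Y\<close> the integer part of the \<open>2 ^ k\<close>-th root of
  \<open>N\<close>, the primes added in passing from \<open>k\<close> to \<open>Suc k\<close>
  satisfy \<open>p \<le> Y < p\<^sup>2\<close>, so each step costs 2. The true size is about k log
  2; only linearity in \<open>k\<close> matters.\<close>

lemma sum_inverse_large_primes_le:
  assumes "N > 0"
  shows "(\<Sum>p | prime p \<and> p \<le> N \<and> N < p ^ 2 ^ k. 1 / real p) \<le> 2 * real k"
proof (induction k)
  case 0
  have "{p. prime p \<and> p \<le> N \<and> N < p ^ 2 ^ 0} = {}" by auto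
  thus ?case by (simp only: sum.empty)
next
  case (Suc k)
  define A where "A = {y. y ^ 2 ^ k \<le> N}"
  define Y where "Y = Max A"
  have le: "y \<le> y ^ 2 ^ k" for y :: nat by (cases "y = 0") (auto intro: self_le_power)
  have A: "finite A" unfolding A_def
    by (rule finite_subset[of _ "{..N}"]) (auto intro: order.trans[OF le])
  have Y: "Y ^ 2 ^ k \<le> N"
  proof -
    have "0 \<in> A" by (simp add: A_def power_0_left)
    hence "Y \<in> A" using Max_in[OF A] unfolding Y_def by blast
    thus ?thesis by (simp add: A_def)
  qed
  have Ymax: "p \<le> Y" if "p ^ 2 ^ k \<le> N" for p
    unfolding Y_def by (rule Max_ge) (use that A in \<open>auto simp: A_def\<close>)
  have sub: "{p. prime p \<and> p \<le> N \<and> N < p ^ 2 ^ Suc k} \<subseteq>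
        {p. prime p \<and> p \<le> N \<and> N < p ^ 2 ^ k} \<union> {p. prime p \<and> p \<le> Y \<and> Y < p\<^sup>2}"
  proof
    fix p assume "p \<in> {p. prime p \<and> p \<le> N \<and> N < p ^ 2 ^ Suc k}"
    hence p: "prime p" "p \<le> N" "N < p ^ 2 ^ Suc k" by auto
    have "p \<le> Y" if "\<not> N < p ^ 2 ^ k" using that by (intro Ymax) auto
    moreover have "Y < p\<^sup>2"
    proof (rule ccontr)
      assume "\<not> Y < p\<^sup>2"
      hence "(p\<^sup>2) ^ 2 ^ k \<le> Y ^ 2 ^ k" by (intro power_mono) auto
      with Y p show False by (simp add: power_mult [symmetric])
    qed
    ultimately show "p \<in> {p. prime p \<and> p \<le> N \<and> N < p ^ 2 ^ k} \<union> {p. prime p \<and> p \<le> Y \<and> Y < p\<^sup>2}"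
      using p by auto
  qed
  have "(\<Sum>p | prime p \<and> p \<le> N \<and> N < p ^ 2 ^ Suc k. 1 / real p) \<le>
    (\<Sum>p\<in>{p. prime p \<and> p \<le> N \<and> N < p ^ 2 ^ k} \<union> {p. prime p \<and> p \<le> Y \<and> Y < p\<^sup>2}. 1 / real p)"
    by (intro sum_mono2 sub) (auto intro: finite_subset[of _ "{..N}"] finite_subset[of _ "{..Y}"])
  also have "\<dots> \<le> (\<Sum>p | prime p \<and> p \<le> N \<and> N < p ^ 2 ^ k. 1 / real p) +
       (\<Sum>p | prime p \<and> p \<le> Y \<and> Y < p\<^sup>2. 1 / real p)"
    by (subst sum.union_inter [symmetric])
       (auto intro: finite_subset[of _ "{..N}"] finite_subset[of _ "{..Y}"] sum_nonneg)
  also have "\<dots> \<le> 2 * real k + 2"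
    by (intro add_mono Suc sum_inverse_primes_sqrt_le)
  finally show ?case by simp
qed

section \<open>The Erdos-Kac theorem for triangular arrays\<close>

lemma exp_minus_approx:
  fixes w :: real
  assumes "w \<ge> 0"
  shows "\<bar>exp (-w) - (1 - w)\<bar> \<le> w\<^sup>2"
proof -
  have "1 - w \<le> exp (-w)" using exp_ge_add_one_self[of "-w"] by simp
  moreover have "exp (-w) \<le> 1 - w + w\<^sup>2"
  proof -
    have "(1 + w) * (1 - w + w\<^sup>2) = 1 + w ^ 3" by (simp add: algebra_simps power2_eq_square power3_eq_cube)
    hence "1 \<le> (1 + w) * (1 - w + w\<^sup>2)" using assms by simp
    also have "\<dots> \<le> exp w * (1 - w + w\<^sup>2)"
    proof (intro mult_right_mono)
      show "0 \<le> 1 - w + w\<^sup>2" using zero_le_power2[of "w - 1/2"]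
        by (simp add: power2_eq_square algebra_simps)
    qed (use exp_ge_add_one_self[of w] in simp)
    finally show ?thesis by (simp add: exp_minus field_simps)
  qed
  ultimately show ?thesis by linarith
qed

text \<open>\<open>\<phi>\<close> is the characteristic function at \<open>\<theta>\<close> of a
  centred Bernoulli variable with parameter \<open>q\<close>, a convex combination of two numbers of
  modulus 1. Its second order expansion is that of a Gaussian of variance
  \<open>q * (1 - q)\<close>; the cubic error is a third absolute moment, the quartic one comes from
  replacing \<open>1 - w\<close> by \<open>exp (- w)\<close>.\<close>

lemma bernoulli_char_approx:
  fixes q \<theta> :: real
  assumes "0 \<le> q" "q \<le> 1"
  defines "\<phi> \<equiv> (1 + of_real q * (iexp \<theta> - 1)) * iexp (- (\<theta> * q))"
  shows "cmod \<phi> \<le> 1"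
    and "cmod (\<phi> - of_real (exp (- (\<theta>\<^sup>2 * (q * (1 - q)) / 2)))) \<le> q * (\<bar>\<theta>\<bar> ^ 3 + \<theta> ^ 4)"
proof -
  \<comment> \<open>The two values of \<open>\<theta>\<close> times the centred variable:
    \<open>x\<close> is taken with probability \<open>1 - q\<close> and \<open>y\<close> with
    probability \<open>q\<close>.\<close>
  define x y where "x = - (\<theta> * q)" and "y = \<theta> * (1 - q)"
  have "iexp y = iexp \<theta> * iexp x"
    by (simp add: x_def y_def algebra_simps flip: exp_add)
  hence \<phi>: "\<phi> = of_real (1 - q) * iexp x + of_real q * iexp y"
    by (simp add: \<phi>_def x_def algebra_simps)
  show "cmod \<phi> \<le> 1"
    unfolding \<phi> by (rule order.trans[OF norm_triangle_ineq]) (use assms in \<open>simp add: norm_mult del: of_real_diff\<close>)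
  define T where "T = (\<lambda>x::real. 1 + \<i> * of_real x - of_real (x\<^sup>2) / 2 :: complex)"
  have T: "cmod (iexp x - T x) \<le> \<bar>x\<bar> ^ 3" for x
  proof -
    have "cmod (iexp x - (\<Sum>k\<le>2. (\<i> * x)^k / fact k)) \<le> \<bar>x\<bar>^(Suc 2) / fact (Suc 2)"
      by (rule iexp_approx1)
    also have "(\<Sum>k\<le>2. (\<i> * x)^k / fact k) = T x"
      by (simp add: T_def numeral_2_eq_2 power2_eq_square field_simps)
    also have "\<bar>x\<bar>^(Suc 2) / fact (Suc 2) \<le> \<bar>x\<bar> ^ 3"
    proof -
      have "(fact (Suc 2) :: real) = 6" "\<bar>x\<bar> ^ Suc 2 = \<bar>x\<bar> ^ 3"
        by (simp_all add: fact_numeral eval_nat_numeral)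
      thus ?thesis by simp
    qed
    finally show ?thesis .
  qed
  define w where "w = \<theta>\<^sup>2 * (q * (1 - q)) / 2"
  have w: "w \<ge> 0" "w \<le> \<theta>\<^sup>2 * q / 2" 
    using assms by (auto simp: w_def intro!: mult_left_mono mult_nonneg_nonneg mult_left_le)
  \<comment> \<open>Centring cancels the linear terms, and the quadratic ones add up to the
    variance.\<close>
  have moments: "of_real (1 - q) * T x + of_real q * T y = of_real (1 - w)"
    by (simp add: T_def x_def y_def w_def power2_eq_square field_simps)
  have "cmod (\<phi> - of_real (1 - w)) = cmod (of_real (1 - q) * (iexp x - T x) + of_real q * (iexp y - T y))"
    unfolding \<phi> moments [symmetric] by (simp only: algebra_simps)
  also have "\<dots> \<le> (1 - q) * cmod (iexp x - T x) + q * cmod (iexp y - T y)"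
    by (rule order.trans[OF norm_triangle_ineq]) (use assms in \<open>simp add: norm_mult del: of_real_diff\<close>)
  also have "\<dots> \<le> (1 - q) * \<bar>x\<bar> ^ 3 + q * \<bar>y\<bar> ^ 3"
    by (intro add_mono mult_left_mono T) (use assms in auto)
  also have "\<dots> = q * \<bar>\<theta>\<bar> ^ 3 * ((1 - q) * (q\<^sup>2 + (1 - q)\<^sup>2))"
    using assms by (simp add: x_def y_def abs_mult power_mult_distrib)
      (simp add: power2_eq_square power3_eq_cube algebra_simps)
  also have "\<dots> \<le> q * \<bar>\<theta>\<bar> ^ 3 * 1"
  proof (intro mult_left_mono)
    have "(1 - q) * (q\<^sup>2 + (1 - q)\<^sup>2) \<le> 1 * (q\<^sup>2 + (1 - q)\<^sup>2)" by (intro mult_right_mono) (use assms in auto)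
    also have "\<dots> \<le> q + (1 - q)" unfolding power2_eq_square mult_1_left by (intro add_mono mult_left_le) (use assms in auto)
    finally show "(1 - q) * (q\<^sup>2 + (1 - q)\<^sup>2) \<le> 1" by simp
  qed (use assms in auto)
  finally have 1: "cmod (\<phi> - of_real (1 - w)) \<le> q * \<bar>\<theta>\<bar> ^ 3" by simp
  have "cmod (of_real (1 - w) - of_real (exp (- w))) = \<bar>exp (- w) - (1 - w)\<bar>"
    by (simp only: norm_of_real abs_minus_commute flip: of_real_diff)
  also have "\<dots> \<le> w\<^sup>2" by (rule exp_minus_approx) (use w in auto)
  also have "\<dots> \<le> (\<theta>\<^sup>2 * q / 2)\<^sup>2" by (intro power_mono w)
  also have "\<dots> \<le> q * \<theta> ^ 4"
  proof -
    have "(\<theta>\<^sup>2 * q / 2)\<^sup>2 = (q * \<theta> ^ 4) * (q / 4)" by (simp add: power2_eq_square eval_nat_numeral)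
    also have "\<dots> \<le> (q * \<theta> ^ 4) * 1" by (intro mult_left_mono) (use assms in auto)
    finally show ?thesis by simp
  qed
  finally have 2: "cmod (of_real (1 - w) - of_real (exp (- w))) \<le> q * \<theta> ^ 4" .
  from norm_triangle_le[OF add_mono[OF 1 2]]
  show "cmod (\<phi> - of_real (exp (- (\<theta>\<^sup>2 * (q * (1 - q)) / 2)))) \<le> q * (\<bar>\<theta>\<bar> ^ 3 + \<theta> ^ 4)"
    by (simp add: w_def algebra_simps)
qed

lemma cmod_iexp_diff_le: "cmod (iexp x - iexp y) \<le> \<bar>x - y\<bar>"
proof -
  have "iexp x - iexp y = iexp y * (iexp (x - y) - 1)"
    by (simp add: algebra_simps flip: exp_add)
  thus ?thesis using iexp_approx1[of "x - y" 0] by (simp add: norm_mult)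
qed

lemma exp_minus_diff_le:
  fixes a b :: real
  assumes "0 \<le> a" "a \<le> b"
  shows "\<bar>exp (-a) - exp (-b)\<bar> \<le> b - a"
proof -
  have "exp (-a) - exp (-b) = exp (-a) * (1 - exp (a - b))"
    by (simp add: algebra_simps flip: exp_add)
  also have "\<dots> \<le> 1 * (b - a)"
  proof (rule mult_mono)
    show "1 - exp (a - b) \<le> b - a" using exp_ge_add_one_self[of "a - b"] by linarith
  qed (use assms in auto)
  finally show ?thesis using assms by simp
qed

lemma iexp_sum: "iexp (\<Sum>p\<in>A. f p) = (\<Prod>p\<in>A. iexp (f p))"
  by (induction A rule: infinite_finite_induct) (auto simp: distrib_left exp_add)

text \<open>On primes with \<open>p ^ 2 ^ k \<le> N\<close> the Rankin weight
  \<open>p\<^sup>s\<close> is at most 2, so the Euler product bounding the error is at most the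
  exponential of \<open>2 * \<bar>t\<bar>\<close> times the mean. The resulting bound no longer
  involves \<open>N\<close>.\<close>

lemma mean_iexp_small_primes_approx:
  fixes h :: "nat \<Rightarrow> real" and N k :: nat and t :: real
  assumes N: "N > 0" and S: "finite S" "\<And>p. p \<in> S \<Longrightarrow> prime p \<and> p ^ 2 ^ k \<le> N"
    and h: "\<And>p. p \<in> S \<Longrightarrow> 0 \<le> h p"
  shows "cmod ((\<Sum>n=1..N. iexp (t * (\<Sum>p\<in>S. if p dvd n then h p else 0))) / of_nat N
               - (\<Prod>p\<in>S. 1 + (iexp (t * h p) - 1) / of_nat p))
         \<le> exp (2 * \<bar>t\<bar> * (\<Sum>p\<in>S. h p / real p)) / 2 ^ 2 ^ k"
\<comment> \<open>For empty \<open>S\<close> both the average and the product are 1. A member of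
  \<open>S\<close> forces \<open>2 ^ 2 ^ k \<le> N\<close>, which is what keeps the exponent
  \<open>s\<close> below at most 1.\<close>
proof (cases "S = {}")
  case False
  have pr: "prime p" "p \<ge> 2" "p > 0" if "p \<in> S" for p
    using S(2)[OF that] by (auto simp: prime_ge_2_nat prime_gt_0_nat)
  from False obtain p where p: "p \<in> S" by auto
  have "2 ^ 2 ^ k \<le> p ^ 2 ^ k" by (rule power_mono) (use pr[OF p] in auto)
  also have "\<dots> \<le> N" using S(2)[OF p] by simp
  finally have "2 ^ 2 ^ k \<le> N" .
  hence "real (2 ^ 2 ^ k) \<le> real N" by (simp only: of_nat_le_iff)
  hence ge: "2 ^ 2 ^ k \<le> real N" by simp
  hence "ln (2 ^ 2 ^ k) \<le> ln (real N)" using N by (subst ln_le_cancel_iff) auto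
  hence lnN: "2 ^ k * ln 2 \<le> ln (real N)" by (simp add: ln_realpow)
  have pos: "0 < 2 ^ k * ln (2::real)" by simp
  \<comment> \<open>With this exponent \<open>N\<^sup>s\<close> is \<open>2 ^ 2 ^ k\<close>, and \<open>p\<^sup>s \<le> 2\<close> holds exactly when \<open>p ^ 2 ^ k \<le> N\<close>.\<close>
  define s where "s = 2 ^ k * ln 2 / ln (real N)"
  have s: "0 \<le> s" "s \<le> 1" "ln (real N) * s = 2 ^ k * ln 2"
  proof -
    have "ln (real N) > 0" using lnN pos by linarith
    thus "0 \<le> s" "s \<le> 1" "ln (real N) * s = 2 ^ k * ln 2" using lnN by (auto simp: s_def)
  qed
  have Ns: "real N powr (-s) = 1 / 2 ^ 2 ^ k"
  proof -
    have "real N powr (-s) = exp (- (2 ^ k * ln 2))"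
      using N s by (simp add: powr_def mult.commute)
    also have "exp (2 ^ k * ln 2) = (2::real) ^ 2 ^ k"
      by (metis exp_ln exp_of_nat_mult of_nat_numeral of_nat_power zero_less_numeral)
    hence "exp (- (2 ^ k * ln 2)) = 1 / (2::real) ^ 2 ^ k" by (simp add: exp_minus divide_simps)
    finally show ?thesis .
  qed
  have ps: "real p powr s \<le> 2" if p: "p \<in> S" for p
  proof -
    have "real (p ^ 2 ^ k) \<le> real N" using S(2)[OF p] by (simp only: of_nat_le_iff)
    hence "ln (real p ^ 2 ^ k) \<le> ln (real N)" using N pr[OF p] by (subst ln_le_cancel_iff) auto
    hence "2 ^ k * ln (real p) \<le> ln (real N)" using pr[OF p] by (simp add: ln_realpow)
    hence "2 ^ k * ln (real p) * s \<le> 2 ^ k * ln 2"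
      unfolding s(3)[symmetric] using s by (intro mult_right_mono) auto
    hence "ln (real p) * s \<le> ln 2" by simp
    hence "exp (ln (real p) * s) \<le> exp (ln 2)" by (subst exp_le_cancel_iff)
    thus ?thesis using pr[OF p] by (simp add: powr_def mult.commute)
  qed
  define a where "a = (\<lambda>p. iexp (t * h p) - 1)"
  have a: "cmod (a p) \<le> \<bar>t\<bar> * h p" if "p \<in> S" for p
    using cmod_iexp_diff_le[of "t * h p" 0] h[OF that] by (simp add: a_def abs_mult)
  have "iexp (t * (\<Sum>p\<in>S. if p dvd n then h p else 0)) = (\<Prod>p\<in>S. 1 + (if p dvd n then a p else 0))" for n
    unfolding sum_distrib_left iexp_sum by (intro prod.cong) (auto simp: a_def)
  hence "cmod ((\<Sum>n=1..N. iexp (t * (\<Sum>p\<in>S. if p dvd n then h p else 0))) / of_nat N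
               - (\<Prod>p\<in>S. 1 + (iexp (t * h p) - 1) / of_nat p)) 
     \<le> real N powr (-s) * (\<Prod>p\<in>S. 1 + cmod (a p) * (real p powr s / real p))"
    using mean_multiplicative_approx[of S N s a] S N s pr by (simp add: a_def)
  also have "\<dots> \<le> real N powr (-s) * (\<Prod>p\<in>S. exp (2 * \<bar>t\<bar> * (h p / real p)))"
  proof (intro mult_left_mono prod_mono conjI)
    fix p assume p: "p \<in> S"
    have "cmod (a p) * (real p powr s / real p) \<le> (\<bar>t\<bar> * h p) * (2 / real p)"
      using a[OF p] h[OF p] ps[OF p] by (intro mult_mono divide_right_mono) auto
    also have "\<dots> = 2 * \<bar>t\<bar> * (h p / real p)" by simp
    finally show "1 + cmod (a p) * (real p powr s / real p) \<le> exp (2 * \<bar>t\<bar> * (h p / real p))"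
      using exp_ge_add_one_self[of "2 * \<bar>t\<bar> * (h p / real p)"] by linarith
  qed (auto intro!: add_nonneg_nonneg)
  also have "\<dots> = exp (2 * \<bar>t\<bar> * (\<Sum>p\<in>S. h p / real p)) / 2 ^ 2 ^ k"
    unfolding Ns exp_sum[OF S(1), symmetric] sum_distrib_left by simp
  finally show ?thesis .
qed (use N in simp)

text \<open>This is the independent model, in which \<open>p\<close> divides with probability
  \<open>1 / p\<close>. All factors have modulus at most 1, so the products differ by at most the
  sum of the differences of the factors (Lindeberg's replacement), and
  \<open>h p \<le> \<epsilon>\<close> bounds each third moment by \<open>\<epsilon>\<close> times a
  second moment.\<close>

lemma prod_bernoulli_char_approx:
  fixes h :: "nat \<Rightarrow> real" and t \<epsilon> :: real
  assumes S: "finite S" "\<And>p. p \<in> S \<Longrightarrow> p \<ge> 2"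
    and h: "\<And>p. p \<in> S \<Longrightarrow> 0 \<le> h p \<and> h p \<le> \<epsilon>"
  defines "V \<equiv> (\<Sum>p\<in>S. (h p)\<^sup>2 / real p * (1 - 1 / real p))"
  shows "cmod ((\<Prod>p\<in>S. 1 + (iexp (t * h p) - 1) / of_nat p) * iexp (- t * (\<Sum>p\<in>S. h p / real p))
               - of_real (exp (- (t\<^sup>2 * V / 2)))) \<le> 2 * t\<^sup>2 * (\<bar>t\<bar> * \<epsilon> + t\<^sup>2 * \<epsilon>\<^sup>2) * V"
proof -
  define \<phi> where "\<phi> = (\<lambda>p. (1 + of_real (1 / real p) * (iexp (t * h p) - 1)) * iexp (- (t * h p * (1 / real p))))"
  define w where "w = (\<lambda>p. (t * h p)\<^sup>2 * (1 / real p * (1 - 1 / real p)) / 2)"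
  have q: "0 \<le> 1 / real p" "1 / real p \<le> 1 / 2" "1 / real p \<le> 1" if "p \<in> S" for p
    using S(2)[OF that] by (auto simp: divide_simps)
  have "(\<Prod>p\<in>S. 1 + (iexp (t * h p) - 1) / of_nat p) * iexp (- t * (\<Sum>p\<in>S. h p / real p)) = (\<Prod>p\<in>S. \<phi> p)"
    unfolding sum_distrib_left iexp_sum \<phi>_def prod.distrib by simp
  moreover have "complex_of_real (exp (- (t\<^sup>2 * V / 2))) = (\<Prod>p\<in>S. of_real (exp (- w p)))"
    unfolding of_real_prod [symmetric] exp_sum[OF S(1), symmetric] sum_negf V_def w_def
    by (simp add: sum_distrib_left sum_divide_distrib power_mult_distrib mult_ac)
  ultimately have "cmod ((\<Prod>p\<in>S. 1 + (iexp (t * h p) - 1) / of_nat p) * iexp (- t * (\<Sum>p\<in>S. h p / real p))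
               - of_real (exp (- (t\<^sup>2 * V / 2)))) = cmod ((\<Prod>p\<in>S. \<phi> p) - (\<Prod>p\<in>S. of_real (exp (- w p))))"
    by simp
  also have "\<dots> \<le> (\<Sum>p\<in>S. cmod (\<phi> p - of_real (exp (- w p))))"
  proof (rule norm_prod_diff)
    fix p assume p: "p \<in> S"
    show "cmod (\<phi> p) \<le> 1" unfolding \<phi>_def by (rule bernoulli_char_approx(1)) (use q[OF p] in auto)
    have "w p \<ge> 0" using q[OF p] unfolding w_def by (intro divide_nonneg_nonneg mult_nonneg_nonneg) auto
    thus "cmod (of_real (exp (- w p))) \<le> 1" by simp
  qed
  also have "\<dots> \<le> (\<Sum>p\<in>S. 2 * t\<^sup>2 * (\<bar>t\<bar> * \<epsilon> + t\<^sup>2 * \<epsilon>\<^sup>2) * ((h p)\<^sup>2 / real p * (1 - 1 / real p)))"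
  proof (intro sum_mono)
    fix p assume p: "p \<in> S"
    \<comment> \<open>The variance weight \<open>c\<close> is at least 1/2 because
      \<open>p \<ge> 2\<close>; comparing \<open>1 / p\<close> with \<open>c / p\<close> is the
      source of the factor 2.\<close>
    define \<theta> c where "\<theta> = t * h p" and "c = 1 - 1 / real p"
    have c: "c \<ge> 1 / 2" using q[OF p] by (simp add: c_def)
    have \<theta>: "\<bar>\<theta>\<bar> \<le> \<bar>t\<bar> * \<epsilon>" using h[OF p] by (simp add: \<theta>_def abs_mult mult_left_mono)
    have "\<bar>\<theta>\<bar> ^ 3 + \<theta> ^ 4 = \<theta>\<^sup>2 * (\<bar>\<theta>\<bar> + \<bar>\<theta>\<bar>\<^sup>2)"
      by (simp add: power2_eq_square power3_eq_cube power4_eq_xxxx algebra_simps)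
    also have "\<dots> \<le> \<theta>\<^sup>2 * (\<bar>t\<bar> * \<epsilon> + (\<bar>t\<bar> * \<epsilon>)\<^sup>2)"
      by (intro mult_left_mono add_mono power_mono \<theta>) auto
    also have "\<dots> = (\<bar>t\<bar> * \<epsilon> + t\<^sup>2 * \<epsilon>\<^sup>2) * (\<theta>\<^sup>2 * 1)" by (simp add: power_mult_distrib)
    also have "\<dots> \<le> (\<bar>t\<bar> * \<epsilon> + t\<^sup>2 * \<epsilon>\<^sup>2) * (\<theta>\<^sup>2 * (2 * c))"
      using c h[OF p] by (intro mult_left_mono) auto
    finally have "1 / real p * (\<bar>\<theta>\<bar> ^ 3 + \<theta> ^ 4) \<le> 1 / real p * ((\<bar>t\<bar> * \<epsilon> + t\<^sup>2 * \<epsilon>\<^sup>2) * (\<theta>\<^sup>2 * (2 * c)))"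
      by (intro mult_left_mono) auto
    moreover have "cmod (\<phi> p - of_real (exp (- w p))) \<le> 1 / real p * (\<bar>\<theta>\<bar> ^ 3 + \<theta> ^ 4)"
      unfolding \<phi>_def w_def \<theta>_def by (rule bernoulli_char_approx(2)) (use q[OF p] in auto)
    moreover have "1 / real p * ((\<bar>t\<bar> * \<epsilon> + t\<^sup>2 * \<epsilon>\<^sup>2) * (\<theta>\<^sup>2 * (2 * c)))
        = 2 * t\<^sup>2 * (\<bar>t\<bar> * \<epsilon> + t\<^sup>2 * \<epsilon>\<^sup>2) * ((h p)\<^sup>2 / real p * c)"
      by (simp add: \<theta>_def power_mult_distrib)
    ultimately show "cmod (\<phi> p - of_real (exp (- w p)))
        \<le> 2 * t\<^sup>2 * (\<bar>t\<bar> * \<epsilon> + t\<^sup>2 * \<epsilon>\<^sup>2) * ((h p)\<^sup>2 / real p * (1 - 1 / real p))"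
      unfolding c_def by linarith
  qed
  also have "\<dots> = 2 * t\<^sup>2 * (\<bar>t\<bar> * \<epsilon> + t\<^sup>2 * \<epsilon>\<^sup>2) * V"
    by (simp add: V_def sum_distrib_left)
  finally show ?thesis .
qed

text \<open>The four errors are, in order: removing the large primes, passing from integers to the
  independent model, comparing that model with a Gaussian of variance \<open>VS\<close>, and the
  missing variance \<open>VL = 1 - VS\<close> of the large primes.\<close>

theorem erdos_kac_char_bound:
  fixes h :: "nat \<Rightarrow> real" and N k :: nat and t \<epsilon> :: real
  defines "P \<equiv> {p. prime p \<and> p \<le> N}"
  defines "m \<equiv> (\<Sum>p\<in>P. h p / real p)"
  assumes N: "N > 0" and h: "\<And>p. p \<in> P \<Longrightarrow> 0 \<le> h p \<and> h p \<le> \<epsilon>" and \<epsilon>: "\<epsilon> \<ge> 0"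
    and V: "(\<Sum>p\<in>P. (h p)\<^sup>2 / real p * (1 - 1 / real p)) = 1"
  shows "cmod ((\<Sum>n=1..N. iexp (t * ((\<Sum>p\<in>P. if p dvd n then h p else 0) - m))) / of_nat N
           - of_real (exp (- t\<^sup>2 / 2)))
         \<le> 4 * \<bar>t\<bar> * real k * \<epsilon> + exp (2 * \<bar>t\<bar> * m) / 2 ^ 2 ^ k
            + 2 * t\<^sup>2 * (\<bar>t\<bar> * \<epsilon> + t\<^sup>2 * \<epsilon>\<^sup>2) + t\<^sup>2 * real k * \<epsilon>\<^sup>2"
proof -
  have finP: "finite P" unfolding P_def by (rule finite_subset[of _ "{..N}"]) auto
  define S where "S = {p\<in>P. p ^ 2 ^ k \<le> N}"
  define L where "L = {p. prime p \<and> p \<le> N \<and> N < p ^ 2 ^ k}"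
  have fin: "finite S" "finite L" "L \<subseteq> P" "S \<subseteq> P" "S \<inter> L = {}" "P = S \<union> L"
    using finP by (auto simp: S_def L_def P_def)
  have split: "(\<Sum>p\<in>P. f p) = (\<Sum>p\<in>S. f p) + (\<Sum>p\<in>L. f p)" for f :: "nat \<Rightarrow> real"
    unfolding fin(6) by (rule sum.union_disjoint) (use fin in auto)
  have p2: "p \<ge> 2" "p > 0" if "p \<in> P" for p using that by (auto simp: P_def prime_ge_2_nat prime_gt_0_nat)
  have invL: "(\<Sum>p\<in>L. 1 / real p) \<le> 2 * real k"
    unfolding L_def by (rule sum_inverse_large_primes_le[OF N])
  define mS mL where "mS = (\<Sum>p\<in>S. h p / real p)" and "mL = (\<Sum>p\<in>L. h p / real p)"
  define VS VL where "VS = (\<Sum>p\<in>S. (h p)\<^sup>2 / real p * (1 - 1 / real p))"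
    and "VL = (\<Sum>p\<in>L. (h p)\<^sup>2 / real p * (1 - 1 / real p))"
  have m: "m = mS + mL" unfolding m_def mS_def mL_def by (rule split)
  have V1: "VS + VL = 1" unfolding VS_def VL_def by (rule trans[OF split[symmetric] V])
  have term_nonneg: "0 \<le> (h p)\<^sup>2 / real p * (1 - 1 / real p)" if "p \<in> P" for p
    using p2[OF that] by (intro mult_nonneg_nonneg) auto
  have VS0: "VS \<ge> 0" unfolding VS_def by (intro sum_nonneg term_nonneg) (use fin in auto)
  have VL0: "VL \<ge> 0" unfolding VL_def by (intro sum_nonneg term_nonneg) (use fin in auto)
  have mL0: "mL \<ge> 0" unfolding mL_def by (intro sum_nonneg divide_nonneg_nonneg) (use fin h in auto)
  have mL: "mL \<le> 2 * real k * \<epsilon>"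
  proof -
    have "mL \<le> (\<Sum>p\<in>L. \<epsilon> * (1 / real p))"
      unfolding mL_def using h fin by (intro sum_mono) (auto intro!: divide_right_mono)
    also have "\<dots> = \<epsilon> * (\<Sum>p\<in>L. 1 / real p)" by (simp add: sum_distrib_left)
    also have "\<dots> \<le> \<epsilon> * (2 * real k)" using invL \<epsilon> by (intro mult_left_mono)
    finally show ?thesis by (simp add: mult_ac)
  qed
  have VL: "VL \<le> 2 * real k * \<epsilon>\<^sup>2"
  proof -
    have "VL \<le> (\<Sum>p\<in>L. \<epsilon>\<^sup>2 * (1 / real p))" unfolding VL_def
    proof (intro sum_mono)
      fix p assume "p \<in> L"
      hence p: "p \<in> P" using fin by auto
      have "(h p)\<^sup>2 / real p * (1 - 1 / real p) \<le> \<epsilon>\<^sup>2 / real p * 1"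
        using p2[OF p] h[OF p] by (intro mult_mono divide_right_mono power_mono) auto
      thus "(h p)\<^sup>2 / real p * (1 - 1 / real p) \<le> \<epsilon>\<^sup>2 * (1 / real p)" by simp
    qed
    also have "\<dots> = \<epsilon>\<^sup>2 * (\<Sum>p\<in>L. 1 / real p)" by (simp add: sum_distrib_left)
    also have "\<dots> \<le> \<epsilon>\<^sup>2 * (2 * real k)" using invL by (intro mult_left_mono) auto
    finally show ?thesis by (simp add: mult_ac)
  qed
  define H HS HL where "H = (\<lambda>n. \<Sum>p\<in>P. if p dvd n then h p else 0)"
    and "HS = (\<lambda>n. \<Sum>p\<in>S. if p dvd n then h p else 0)" and "HL = (\<lambda>n. \<Sum>p\<in>L. if p dvd n then h p else 0)"
  have H: "H n = HS n + HL n" for n unfolding H_def HS_def HL_def by (rule split)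
  have HL0: "HL n \<ge> 0" for n unfolding HL_def using h fin by (intro sum_nonneg) auto
  have sumHL: "(\<Sum>n=1..N. HL n) \<le> real N * mL"
  proof -
    have "(\<Sum>n=1..N. HL n) = (\<Sum>p\<in>L. \<Sum>n=1..N. if p dvd n then h p else 0)"
      unfolding HL_def by (rule sum.swap)
    also have "\<dots> = (\<Sum>p\<in>L. real (N div p) * h p)"
      using p2 fin by (intro sum.cong refl sum_dvd_eq) auto
    also have "\<dots> \<le> (\<Sum>p\<in>L. real N / real p * h p)"
      using h fin by (intro sum_mono mult_right_mono of_nat_div_le_of_nat) auto
    also have "\<dots> = real N * mL" by (simp add: mL_def sum_distrib_left)
    finally show ?thesis .
  qed
  define E where "E = (\<Sum>n=1..N. iexp (t * (H n - m)))"
  define ES where "ES = (\<Sum>n=1..N. iexp (t * (HS n - mS)))"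
  \<comment> \<open>The large primes are removed in mean: \<open>HL\<close> and \<open>mL\<close>
    are nonnegative and both have average at most \<open>2 * k * \<epsilon>\<close>, whence the
    constant 4.\<close>
  have "cmod (E - ES) \<le> (\<Sum>n=1..N. cmod (iexp (t * (H n - m)) - iexp (t * (HS n - mS))))"
    unfolding E_def ES_def sum_subtractf[symmetric] by (rule norm_sum)
  also have "\<dots> \<le> (\<Sum>n=1..N. \<bar>t\<bar> * (HL n + mL))"
  proof (intro sum_mono)
    fix n
    have "cmod (iexp (t * (H n - m)) - iexp (t * (HS n - mS))) \<le> \<bar>t * (H n - m) - t * (HS n - mS)\<bar>"
      by (rule cmod_iexp_diff_le)
    also have "\<dots> = \<bar>t\<bar> * \<bar>HL n - mL\<bar>" by (simp add: H m algebra_simps flip: abs_mult)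
    also have "\<dots> \<le> \<bar>t\<bar> * (HL n + mL)" using HL0[of n] mL0 by (intro mult_left_mono) auto
    finally show "cmod (iexp (t * (H n - m)) - iexp (t * (HS n - mS))) \<le> \<dots>" .
  qed
  also have "\<dots> = \<bar>t\<bar> * ((\<Sum>n=1..N. HL n) + real N * mL)"
    by (simp add: sum.distrib flip: sum_distrib_left)
  also have "\<dots> \<le> \<bar>t\<bar> * (real N * (2 * real k * \<epsilon>) + real N * (2 * real k * \<epsilon>))"
    using order.trans[OF sumHL mult_left_mono[OF mL, of "real N"]] mult_left_mono[OF mL, of "real N"]
    by (intro mult_left_mono[OF add_mono]) auto
  finally have "cmod (E - ES) / real N \<le> 4 * \<bar>t\<bar> * real k * \<epsilon>"
    using N by (simp add: field_simps)
  hence 1: "cmod (E / of_nat N - ES / of_nat N) \<le> 4 * \<bar>t\<bar> * real k * \<epsilon>"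
    by (simp add: norm_divide flip: diff_divide_distrib)
  define \<Phi> where "\<Phi> = (\<Prod>p\<in>S. 1 + (iexp (t * h p) - 1) / of_nat p)"
  have ES: "ES / of_nat N = (\<Sum>n=1..N. iexp (t * HS n)) / of_nat N * iexp (- t * mS)"
    unfolding ES_def sum_divide_distrib sum_distrib_right
    by (intro sum.cong refl) (simp add: algebra_simps flip: exp_add)
  have "cmod (ES / of_nat N - \<Phi> * iexp (- t * mS)) =
          cmod ((\<Sum>n=1..N. iexp (t * HS n)) / of_nat N - \<Phi>) * cmod (iexp (- t * mS))"
    unfolding ES norm_mult[symmetric] by (simp only: left_diff_distrib)
  also have "\<dots> \<le> exp (2 * \<bar>t\<bar> * mS) / 2 ^ 2 ^ k * 1"
    unfolding HS_def \<Phi>_def mS_def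
    by (intro mult_mono mean_iexp_small_primes_approx) (use N fin h in \<open>auto simp: S_def P_def\<close>)
  also have "\<dots> \<le> exp (2 * \<bar>t\<bar> * m) / 2 ^ 2 ^ k"
    using mL0 by (simp add: m divide_right_mono mult_left_mono)
  finally have 2: "cmod (ES / of_nat N - \<Phi> * iexp (- t * mS)) \<le> exp (2 * \<bar>t\<bar> * m) / 2 ^ 2 ^ k" .
  have "cmod (\<Phi> * iexp (- t * mS) - of_real (exp (- (t\<^sup>2 * VS / 2)))) \<le> 2 * t\<^sup>2 * (\<bar>t\<bar> * \<epsilon> + t\<^sup>2 * \<epsilon>\<^sup>2) * VS"
    unfolding \<Phi>_def mS_def VS_def
    by (rule prod_bernoulli_char_approx) (use fin p2 h in auto)
  also have "\<dots> \<le> 2 * t\<^sup>2 * (\<bar>t\<bar> * \<epsilon> + t\<^sup>2 * \<epsilon>\<^sup>2) * 1"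
    using V1 VL0 \<epsilon> by (intro mult_left_mono) auto
  finally have 3: "cmod (\<Phi> * iexp (- t * mS) - of_real (exp (- (t\<^sup>2 * VS / 2)))) \<le> 2 * t\<^sup>2 * (\<bar>t\<bar> * \<epsilon> + t\<^sup>2 * \<epsilon>\<^sup>2)"
    by simp
  have "cmod (of_real (exp (- (t\<^sup>2 * VS / 2))) - of_real (exp (- t\<^sup>2 / 2)))
        = \<bar>exp (- (t\<^sup>2 * VS / 2)) - exp (- (t\<^sup>2 / 2))\<bar>"
    by (simp flip: of_real_diff)
  also have "\<dots> \<le> t\<^sup>2 / 2 - t\<^sup>2 * VS / 2"
    using VS0 V1 VL0 by (intro exp_minus_diff_le) (auto intro!: mult_left_le)
  also have "\<dots> = t\<^sup>2 * (VL / 2)"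
  proof -
    have "VS = 1 - VL" using V1 by simp
    show ?thesis unfolding \<open>VS = 1 - VL\<close> by (simp add: field_simps)
  qed
  also have "\<dots> \<le> t\<^sup>2 * (real k * \<epsilon>\<^sup>2)" using VL by (intro mult_left_mono) auto
  finally have 4: "cmod (of_real (exp (- (t\<^sup>2 * VS / 2))) - of_real (exp (- t\<^sup>2 / 2))) \<le> t\<^sup>2 * real k * \<epsilon>\<^sup>2"
    by (simp add: mult_ac)
  from norm_diff_triangle_le[OF norm_diff_triangle_le[OF norm_diff_triangle_le[OF 1 2] 3] 4] show ?thesis
    unfolding E_def H_def .
qed

text \<open>The error of \<open>erdos_kac_char_bound\<close> for a cutoff \<open>k\<close> between
  \<open>1 / sqrt e\<close> and \<open>1 / sqrt e + 1\<close> and a mean at most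
  \<open>C / e\<close>. Then \<open>k * e\<close> is of order \<open>sqrt e\<close>, while
  \<open>2 powr (2 powr (1 / sqrt e))\<close> outgrows every \<open>exp (C' / e)\<close>.\<close>

lemma erdos_kac_error_tendsto_0:
  fixes a C :: real
  assumes "a \<ge> 0" "C > 0"
  shows "((\<lambda>e. 4 * a * (1 / sqrt e + 1) * e + exp (2 * a * (C / e)) / 2 powr (2 powr (1 / sqrt e))
     + 2 * a\<^sup>2 * (a * e + a\<^sup>2 * e\<^sup>2) + a\<^sup>2 * (1 / sqrt e + 1) * e\<^sup>2) \<longlongrightarrow> 0) (at_right 0)"
proof (cases "a = 0")
  case True
  have "((\<lambda>e::real. 1 / 2 powr (2 powr (1 / sqrt e))) \<longlongrightarrow> 0) (at_right 0)" by real_asymp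
  thus ?thesis using True by simp
next
  case False
  with assms have "a > 0" by simp
  thus ?thesis using assms by real_asymp
qed

text \<open>Variance 1 together with values at most \<open>\<epsilon> N\<close> already forces a
  mean of at least \<open>1 / \<epsilon> N\<close>, so the bound \<open>C / \<epsilon> N\<close>
  demands the smallest possible order. It is here that the comparability of means and variances
  enters.\<close>

theorem erdos_kac_char_tendsto:
  fixes h :: "nat \<Rightarrow> nat \<Rightarrow> real" and \<epsilon> :: "nat \<Rightarrow> real" and C t :: real
  defines "P \<equiv> (\<lambda>N. {p. prime p \<and> p \<le> (N :: nat)})"
  defines "m \<equiv> (\<lambda>N. \<Sum>p\<in>P N. h N p / real p)"
  assumes h: "eventually (\<lambda>N. \<forall>p\<in>P N. 0 \<le> h N p \<and> h N p \<le> \<epsilon> N) sequentially"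
    and V: "eventually (\<lambda>N. (\<Sum>p\<in>P N. (h N p)\<^sup>2 / real p * (1 - 1 / real p)) = 1) sequentially"
    and m: "eventually (\<lambda>N. m N \<le> C / \<epsilon> N) sequentially"
    and \<epsilon>: "eventually (\<lambda>N. \<epsilon> N > 0) sequentially" "\<epsilon> \<longlonglongrightarrow> 0" and C: "C > 0"
  shows "(\<lambda>N. (\<Sum>n=1..N. iexp (t * ((\<Sum>p\<in>P N. if p dvd n then h N p else 0) - m N))) / of_nat N)
          \<longlonglongrightarrow> of_real (exp (- t\<^sup>2 / 2))"
proof (rule LIM_zero_cancel, rule Lim_null_comparison)
  define F where "F = (\<lambda>e. 4 * \<bar>t\<bar> * (1 / sqrt e + 1) * e + exp (2 * \<bar>t\<bar> * (C / e)) / 2 powr (2 powr (1 / sqrt e))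
     + 2 * \<bar>t\<bar>\<^sup>2 * (\<bar>t\<bar> * e + \<bar>t\<bar>\<^sup>2 * e\<^sup>2) + \<bar>t\<bar>\<^sup>2 * (1 / sqrt e + 1) * e\<^sup>2)"
  have "(F \<longlongrightarrow> 0) (at_right 0)"
    unfolding F_def by (rule erdos_kac_error_tendsto_0) (use C in auto)
  moreover have "filterlim \<epsilon> (at_right 0) sequentially"
    using \<epsilon> by (auto simp: filterlim_at elim: eventually_mono)
  ultimately show "(\<lambda>N. F (\<epsilon> N)) \<longlonglongrightarrow> 0"
    by (rule filterlim_compose)
  show "eventually (\<lambda>N. cmod ((\<Sum>n=1..N. iexp (t * ((\<Sum>p\<in>P N. if p dvd n then h N p else 0) - m N))) / of_nat N
           - of_real (exp (- t\<^sup>2 / 2))) \<le> F (\<epsilon> N)) sequentially"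
    using h V m \<epsilon>(1) eventually_gt_at_top[of 0]
  proof eventually_elim
    case (elim N)
    define e where "e = \<epsilon> N"
    have e: "e > 0" using elim by (simp add: e_def)
    \<comment> \<open>The cutoff must satisfy \<open>k * e \<rightarrow> 0\<close>, so that the large primes are negligible, while
      \<open>2 ^ k\<close> outgrows the mean, which is of order \<open>1 / e\<close>.\<close>
    define k where "k = nat \<lceil>1 / sqrt e\<rceil>"
    have k: "1 / sqrt e \<le> real k" "real k \<le> 1 / sqrt e + 1"
      using e by (auto simp: k_def)
    have "2 powr (1 / sqrt e) \<le> 2 powr real k" using k by (intro powr_mono) auto
    also have "\<dots> = real (2 ^ k)" by (simp add: powr_realpow)
    finally have "2 powr (2 powr (1 / sqrt e)) \<le> 2 powr real (2 ^ k)" by (intro powr_mono) auto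
    also have "\<dots> = 2 ^ 2 ^ k" by (subst powr_realpow) auto
    finally have k2: "2 powr (2 powr (1 / sqrt e)) \<le> 2 ^ 2 ^ k" .
    have "2 * \<bar>t\<bar> * m N \<le> 2 * \<bar>t\<bar> * (C / e)"
      using elim by (intro mult_left_mono) (auto simp: e_def)
    hence em: "exp (2 * \<bar>t\<bar> * m N) \<le> exp (2 * \<bar>t\<bar> * (C / e))" by (subst exp_le_cancel_iff)
    have "cmod ((\<Sum>n=1..N. iexp (t * ((\<Sum>p\<in>P N. if p dvd n then h N p else 0) - m N))) / of_nat N
           - of_real (exp (- t\<^sup>2 / 2))) \<le> 4 * \<bar>t\<bar> * real k * e + exp (2 * \<bar>t\<bar> * m N) / 2 ^ 2 ^ k
            + 2 * t\<^sup>2 * (\<bar>t\<bar> * e + t\<^sup>2 * e\<^sup>2) + t\<^sup>2 * real k * e\<^sup>2"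
      unfolding m_def P_def by (rule erdos_kac_char_bound) (use elim in \<open>auto simp: e_def P_def\<close>)
    also have "\<dots> \<le> F e"
      unfolding F_def power2_abs
      by (intro add_mono mult_mono frac_le k k2 em order.refl)
         (use e in auto)
    finally show ?case by (simp add: e_def)
  qed
qed

section \<open>Convergence in distribution\<close>

lemma char_distr_pmf_of_set:
  assumes "finite A" "A \<noteq> {}"
  shows "char (distr (measure_pmf (pmf_of_set A)) borel X) t = (\<Sum>n\<in>A. iexp (t * X n)) / of_nat (card A)"
proof -
  have "char (distr (measure_pmf (pmf_of_set A)) borel X) t = (CLINT n|measure_pmf (pmf_of_set A). iexp (t * X n))"
    unfolding char_def by (subst integral_distr) auto
  also have "\<dots> = (\<Sum>n\<in>A. pmf (pmf_of_set A) n *\<^sub>R iexp (t * X n))"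
    by (rule integral_measure_pmf) (use assms in auto)
  also have "\<dots> = (\<Sum>n\<in>A. iexp (t * X n)) / of_nat (card A)"
    unfolding sum_divide_distrib using assms by (intro sum.cong) (auto simp: scaleR_conv_of_real)
  finally show ?thesis .
qed

lemma normal_limit_of_mean_iexp:
  fixes X :: "nat \<Rightarrow> nat \<Rightarrow> real" and u :: real
  assumes "\<And>t. (\<lambda>N. (\<Sum>n=1..N. iexp (t * X N n)) / of_nat N) \<longlonglongrightarrow> of_real (exp (- t\<^sup>2 / 2))"
  shows "(\<lambda>N. real (card {n\<in>{1..N}. X N n < u}) / real N)
           \<longlonglongrightarrow> 1 / sqrt (2 * pi) * (LBINT t:{..u}. exp (- t\<^sup>2 / 2))"
proof -
  \<comment> \<open>The index is shifted by one because there is no uniform distribution on the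
    empty set \<open>{1..0}\<close>.\<close>
  define M where "M = (\<lambda>N. distr (measure_pmf (pmf_of_set {1..Suc N})) borel (X (Suc N)))"
  have M: "real_distribution (M N)" for N
    unfolding M_def by (rule prob_space.real_distribution_distr) (auto intro: measure_pmf.prob_space_axioms)
  have "weak_conv_m M std_normal_distribution"
  proof (rule levy_continuity[OF M real_dist_normal_dist])
    fix t
    show "(\<lambda>N. char (M N) t) \<longlonglongrightarrow> char std_normal_distribution t"
      using LIMSEQ_Suc[OF assms[of t]]
      by (simp add: M_def char_distr_pmf_of_set char_std_normal_distribution)
  qed
  hence "(\<lambda>N. measure (M N) {..<u}) \<longlonglongrightarrow> measure std_normal_distribution {..<u}"
  \<comment> \<open>The normal law has no atom at \<open>u\<close>, so the open half line is a
    continuity set and the strict inequality is admissible.\<close>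
  proof (rule weak_conv_imp_continuity_set_conv[OF M real_dist_normal_dist])
    have "emeasure std_normal_distribution {u} = 0"
      by (subst emeasure_density) (auto simp: nn_integral_indicator_singleton')
    moreover have "frontier {..<u} = {u}" by (auto simp: frontier_def interior_open)
    ultimately show "emeasure std_normal_distribution (frontier {..<u}) = 0"
      by simp
  qed auto
  also have "(\<lambda>N. measure (M N) {..<u}) = (\<lambda>N. real (card {n\<in>{1..Suc N}. X (Suc N) n < u}) / real (Suc N))"
  proof
    fix N
    have "measure (M N) {..<u} = measure (measure_pmf (pmf_of_set {1..Suc N})) {n. X (Suc N) n < u}"
      unfolding M_def by (subst measure_distr) (auto intro!: arg_cong[where f = "measure _"])
    thus "measure (M N) {..<u} = real (card {n\<in>{1..Suc N}. X (Suc N) n < u}) / real (Suc N)"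
      by (simp add: measure_pmf_of_set Int_def)
  qed
  also have "measure std_normal_distribution {..<u} = 1 / sqrt (2 * pi) * (LBINT t:{..u}. exp (- t\<^sup>2 / 2))"
  proof -
    have "measure std_normal_distribution {..<u} = (\<integral>t. indicator {..<u} t \<partial>std_normal_distribution)"
      by simp
    also have "\<dots> = (LBINT t. std_normal_density t *\<^sub>R indicator {..<u} t)"
      by (rule integral_density) auto
    also have "\<dots> = (LBINT t. 1 / sqrt (2 * pi) * (indicator {..u} t *\<^sub>R exp (- t\<^sup>2 / 2)))"
    proof (rule integral_cong_AE)
      show "AE t in lborel. std_normal_density t *\<^sub>R indicator {..<u} t
              = 1 / sqrt (2 * pi) * (indicator {..u} t *\<^sub>R exp (- t\<^sup>2 / 2))"
        using AE_lborel_singleton[of u]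
        by eventually_elim (auto simp: std_normal_density_def indicator_def)
    qed auto
    finally show ?thesis unfolding set_lebesgue_integral_def by simp
  qed
  finally show ?thesis by (rule LIMSEQ_imp_Suc)
qed

text \<open>A form of Slutsky's theorem for characteristic functions: \<open>iexp\<close> is
  1-Lipschitz where \<open>X\<close> and \<open>Y\<close> are close, and the remaining
  \<open>n\<close>, of density tending to 0, contribute at most 2 each.\<close>

lemma mean_iexp_tendsto_cong_prob:
  fixes X Y :: "nat \<Rightarrow> nat \<Rightarrow> real"
  assumes X: "(\<lambda>N. (\<Sum>n=1..N. iexp (t * X N n)) / of_nat N) \<longlonglongrightarrow> c"
    and diff: "\<And>\<delta>. \<delta> > 0 \<Longrightarrow> (\<lambda>N. real (card {n\<in>{1..N}. \<bar>X N n - Y N n\<bar> > \<delta>}) / real N) \<longlonglongrightarrow> 0"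
  shows "(\<lambda>N. (\<Sum>n=1..N. iexp (t * Y N n)) / of_nat N) \<longlonglongrightarrow> c"
proof -
  have le: "cmod ((\<Sum>n=1..N. iexp (t * Y N n)) / of_nat N - (\<Sum>n=1..N. iexp (t * X N n)) / of_nat N)
     \<le> \<bar>t\<bar> * \<delta> + 2 * (real (card {n\<in>{1..N}. \<bar>X N n - Y N n\<bar> > \<delta>}) / real N)"
    if "\<delta> > 0" "N > 0" for N \<delta>
  proof -
    have "cmod ((\<Sum>n=1..N. iexp (t * Y N n)) - (\<Sum>n=1..N. iexp (t * X N n)))
       \<le> (\<Sum>n=1..N. cmod (iexp (t * Y N n) - iexp (t * X N n)))"
      unfolding sum_subtractf[symmetric] by (rule norm_sum)
    also have "\<dots> \<le> (\<Sum>n=1..N. \<bar>t\<bar> * \<delta> + 2 * (if \<bar>X N n - Y N n\<bar> > \<delta> then 1 else 0))"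
    proof (intro sum_mono)
      fix n
      have "cmod (iexp (t * Y N n) - iexp (t * X N n)) \<le> 2"
        by (rule order.trans[OF norm_triangle_ineq4]) simp
      moreover have "cmod (iexp (t * Y N n) - iexp (t * X N n)) \<le> \<bar>t\<bar> * \<bar>X N n - Y N n\<bar>"
        using cmod_iexp_diff_le[of "t * Y N n" "t * X N n"]
        by (simp add: abs_minus_commute[of "X N n"] flip: abs_mult right_diff_distrib)
      moreover have "\<bar>t\<bar> * \<bar>X N n - Y N n\<bar> \<le> \<bar>t\<bar> * \<delta>" if "\<not> \<bar>X N n - Y N n\<bar> > \<delta>"
        using that by (intro mult_left_mono) auto
      moreover have "\<bar>t\<bar> * \<delta> \<ge> 0" using \<open>\<delta> > 0\<close> by simp
      ultimately show "cmod (iexp (t * Y N n) - iexp (t * X N n))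
          \<le> \<bar>t\<bar> * \<delta> + 2 * (if \<bar>X N n - Y N n\<bar> > \<delta> then 1 else 0)" by (auto split: if_splits)
    qed
    also have "\<dots> = real N * (\<bar>t\<bar> * \<delta>) + 2 * real (card {n\<in>{1..N}. \<bar>X N n - Y N n\<bar> > \<delta>})"
      using sum.inter_filter[of "{1..N}" "\<lambda>_. 1 :: real" "\<lambda>n. \<bar>X N n - Y N n\<bar> > \<delta>"]
      by (simp add: sum.distrib flip: sum_distrib_left)
    finally show ?thesis using \<open>N > 0\<close>
      by (simp add: norm_divide divide_le_eq algebra_simps flip: diff_divide_distrib)
  qed
  have "(\<lambda>N. (\<Sum>n=1..N. iexp (t * Y N n)) / of_nat N - (\<Sum>n=1..N. iexp (t * X N n)) / of_nat N) \<longlonglongrightarrow> 0"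
  proof (rule tendstoI)
    fix e :: real assume e: "e > 0"
    \<comment> \<open>Half of \<open>e\<close> is spent on the Lipschitz term and half on twice the
      exceptional density. The summand 1 covers \<open>t = 0\<close>.\<close>
    define \<delta> where "\<delta> = e / (2 * (\<bar>t\<bar> + 1))"
    have \<delta>: "\<delta> > 0" using e by (simp add: \<delta>_def)
    have "\<bar>t\<bar> * \<delta> \<le> (\<bar>t\<bar> + 1) * \<delta>" using \<delta> by (intro mult_right_mono) auto
    also have "\<dots> = e / 2" by (simp add: \<delta>_def divide_simps)
    finally have t\<delta>: "\<bar>t\<bar> * \<delta> \<le> e / 2" .
    have "eventually (\<lambda>N. real (card {n\<in>{1..N}. \<bar>X N n - Y N n\<bar> > \<delta>}) / real N < e / 4) sequentially"
      by (rule order_tendstoD(2)[OF diff[OF \<delta>]]) (use e in auto)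
    thus "eventually (\<lambda>N. dist ((\<Sum>n=1..N. iexp (t * Y N n)) / of_nat N - (\<Sum>n=1..N. iexp (t * X N n)) / of_nat N) 0 < e) sequentially"
      using eventually_gt_at_top[of 0]
    proof eventually_elim
      case (elim N)
      from le[OF \<delta> elim(2)] elim(1) t\<delta> show ?case unfolding dist_norm diff_0_right by linarith
    qed
  qed
  from tendsto_add[OF this X] show ?thesis by simp
qed

section \<open>Strongly additive functions\<close>

text \<open>Only an upper bound for the second moment is needed, so the floors in the counts of
  multiples of \<open>p * q\<close> can simply be dropped and the many pairs cause no rounding
  error. The diagonal contributes \<open>G * m\<close> and the rounding in the first moment
  \<open>2 * G * m\<close>, which makes 3.\<close>

lemma turan_kubilius_bounded:
  fixes h :: "nat \<Rightarrow> real" and N :: nat and G :: real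
  defines "P \<equiv> {p. prime p \<and> p \<le> N}"
  defines "m \<equiv> (\<Sum>p\<in>P. h p / real p)"
  assumes h: "\<And>p. p \<in> P \<Longrightarrow> 0 \<le> h p \<and> h p \<le> G" and G: "G \<ge> 0"
  shows "(\<Sum>n=1..N. ((\<Sum>p\<in>P. if p dvd n then h p else 0) - m)\<^sup>2) \<le> 3 * G * m * real N"
proof -
  have finP: "finite P" unfolding P_def by (rule finite_subset[of _ "{..N}"]) auto
  have pos: "p > 0" if "p \<in> P" for p using that by (auto simp: P_def prime_gt_0_nat)
  have m0: "m \<ge> 0" unfolding m_def by (intro sum_nonneg divide_nonneg_nonneg) (use h in auto)
  have "card P \<le> card {1..N}" by (rule card_mono) (use pos in \<open>auto simp: P_def Suc_le_eq\<close>)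
  hence cP: "real (card P) \<le> real N" by simp
  define H where "H = (\<lambda>n. \<Sum>p\<in>P. if p dvd n then h p else 0)"
  have "(\<Sum>n=1..N. H n) = (\<Sum>p\<in>P. \<Sum>n=1..N. if p dvd n then h p else 0)"
    unfolding H_def by (rule sum.swap)
  also have "\<dots> = (\<Sum>p\<in>P. real (N div p) * h p)"
    using pos by (intro sum.cong refl sum_dvd_eq) auto
  \<comment> \<open>Each prime loses at most \<open>h p \<le> G\<close>; bounding the number of
    primes by \<open>N\<close> is enough.\<close>
  also have "\<dots> \<ge> (\<Sum>p\<in>P. real N * (h p / real p) - G)"
  proof (intro sum_mono)
    fix p assume p: "p \<in> P"
    have "real N / real p - 1 \<le> real (N div p)"
      using floor_divide_of_nat_eq[of N p, where 'a = real] by linarith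
    hence "(real N / real p - 1) * h p \<le> real (N div p) * h p" using h[OF p] by (intro mult_right_mono) auto
    thus "real N * (h p / real p) - G \<le> real (N div p) * h p" using h[OF p] by (simp add: algebra_simps)
  qed
  also have "(\<Sum>p\<in>P. real N * (h p / real p) - G) = real N * m - real (card P) * G"
    by (simp add: sum_subtractf m_def sum_distrib_left)
  finally have H1: "real N * m - real N * G \<le> (\<Sum>n=1..N. H n)"
    using mult_right_mono[OF cP G] by linarith
  have "(\<Sum>n=1..N. (H n)\<^sup>2) = (\<Sum>n=1..N. \<Sum>p\<in>P. \<Sum>q\<in>P. if p dvd n \<and> q dvd n then h p * h q else 0)"
    unfolding power2_eq_square H_def sum_product by (intro sum.cong refl) auto
  also have "\<dots> = (\<Sum>p\<in>P. \<Sum>n=1..N. \<Sum>q\<in>P. if p dvd n \<and> q dvd n then h p * h q else 0)"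
    by (rule sum.swap)
  also have "\<dots> = (\<Sum>p\<in>P. \<Sum>q\<in>P. \<Sum>n=1..N. if p dvd n \<and> q dvd n then h p * h q else 0)"
    by (intro sum.cong refl sum.swap)
  also have "\<dots> \<le> (\<Sum>p\<in>P. \<Sum>q\<in>P. real N * (h p / real p) * (h q / real q) + (if p = q then real N * G * (h p / real p) else 0))"
  proof (intro sum_mono)
    fix p q assume pq: "p \<in> P" "q \<in> P"
    have div_le: "real (N div d) * c \<le> real N / real d * c" if "c \<ge> 0" for d c
      using that by (intro mult_right_mono of_nat_div_le_of_nat) auto
    have hh: "h p * h q \<ge> 0" using h pq by auto
    show "(\<Sum>n=1..N. if p dvd n \<and> q dvd n then h p * h q else 0)
       \<le> real N * (h p / real p) * (h q / real q) + (if p = q then real N * G * (h p / real p) else 0)"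
    proof (cases "p = q")
      case True
      have "(\<Sum>n=1..N. if p dvd n \<and> q dvd n then h p * h q else 0) = real (N div p) * (h p * h p)"
        unfolding True[symmetric] conj_absorb by (rule sum_dvd_eq[OF pos[OF pq(1)]])
      also have "\<dots> \<le> real N / real p * (h p * h p)" using hh True by (intro div_le) auto
      also have "\<dots> \<le> real N / real p * (G * h p)" using h[OF pq(1)] by (intro mult_left_mono mult_right_mono) auto
      finally show ?thesis using True h[OF pq(1)]
        by (simp add: mult_ac) (smt (verit) zero_le_mult_iff zero_le_divide_iff of_nat_0_le_iff)
    next
      case False
      hence "coprime p q" using pq by (intro primes_coprime) (auto simp: P_def)
      hence "p dvd n \<and> q dvd n \<longleftrightarrow> p * q dvd n" for n
        by (meson divides_mult dvd_mult_left dvd_mult_right)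
      hence "(\<Sum>n=1..N. if p dvd n \<and> q dvd n then h p * h q else 0) = real (N div (p * q)) * (h p * h q)"
        using sum_dvd_eq[where d = "p * q" and N = N and c = "h p * h q"] pos pq by simp
      also have "\<dots> \<le> real N / real (p * q) * (h p * h q)" using hh by (rule div_le)
      finally show ?thesis using False by simp
    qed
  qed
  also have "\<dots> = real N * (\<Sum>p\<in>P. \<Sum>q\<in>P. (h p / real p) * (h q / real q)) + real N * G * m"
    using finP by (simp add: sum.distrib m_def sum_distrib_left mult_ac)
  also have "(\<Sum>p\<in>P. \<Sum>q\<in>P. (h p / real p) * (h q / real q)) = m\<^sup>2"
    unfolding m_def power2_eq_square sum_product ..
  finally have H2: "(\<Sum>n=1..N. (H n)\<^sup>2) \<le> real N * m\<^sup>2 + real N * G * m" .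
  have "(\<Sum>n=1..N. (H n - m)\<^sup>2) = (\<Sum>n=1..N. (H n)\<^sup>2) - 2 * m * (\<Sum>n=1..N. H n) + real N * m\<^sup>2"
    by (simp add: power2_diff sum.distrib sum_subtractf sum_distrib_left sum_distrib_right mult_ac)
  also have "\<dots> \<le> (real N * m\<^sup>2 + real N * G * m) - 2 * m * (real N * m - real N * G) + real N * m\<^sup>2"
    using H2 m0 by (intro add_mono diff_mono mult_left_mono[OF H1] order.refl) auto
  also have "\<dots> = 3 * G * m * real N" by (simp add: power2_eq_square algebra_simps)
  finally show ?thesis unfolding H_def .
qed

text \<open>Writing the value as a sum over all primes up to \<open>N\<close> makes the index set
  independent of \<open>n\<close>, so that sums over \<open>n\<close> and \<open>p\<close> can be
  interchanged.\<close>

lemma strongly_additive_eq_sum_primes: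
  assumes g: "strongly_additive g" and n: "n \<in> {1..N}"
  shows "g n = (\<Sum>p | prime p \<and> p \<le> N. if p dvd n then g p else 0)"
proof -
  have add: "g (a * b) = g a + g b" if "coprime a b" for a b
    using g that by (auto simp: strongly_additive_def additive_def)
  have pow: "g (p ^ a) = g p" if "prime p" "a \<ge> 1" for p a
    using g that by (auto simp: strongly_additive_def)
  have g1: "g 1 = 0" using add[of 1 1] by simp
  have prod: "g (\<Prod>p\<in>A. p ^ multiplicity p n) = (\<Sum>p\<in>A. g p)" if "finite A" "A \<subseteq> prime_factors n" for A
    using that
  proof (induction A rule: finite_induct)
    case (insert p A)
    have cp: "coprime p q" if "q \<in> A" for q
      using insert that by (intro primes_coprime) auto
    have "coprime (p ^ multiplicity p n) (\<Prod>q\<in>A. q ^ multiplicity q n)"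
      using cp by (intro prod_coprime_right) simp
    moreover have "multiplicity p n \<ge> 1"
      using insert n by (auto simp: prime_factors_multiplicity Suc_le_eq)
    ultimately show ?case using insert add pow by (auto simp: in_prime_factors_iff)
  qed (use g1 in auto)
  have "g n = g (\<Prod>p\<in>prime_factors n. p ^ multiplicity p n)"
    using n by (subst prime_factorization_nat[symmetric]) auto
  also have "\<dots> = (\<Sum>p\<in>prime_factors n. g p)" by (rule prod) auto
  also have "prime_factors n = {p\<in>{p. prime p \<and> p \<le> N}. p dvd n}"
    using n by (auto simp: in_prime_factors_iff intro: order.trans[OF dvd_imp_le[of _ n]])
  also have "(\<Sum>p\<in>\<dots>. g p) = (\<Sum>p | prime p \<and> p \<le> N. if p dvd n then g p else 0)"
    by (rule sum.inter_filter) (auto intro: finite_subset[of _ "{..N}"])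
  finally show ?thesis .
qed

section \<open>Linearization of the polynomial\<close>

text \<open>A product rule for expansions 1 + (linear part) + O(\<tau>^2). The constant is explicit
  and free of the variables, so the inductions below yield bounds uniform in \<open>y\<close> and
  \<open>\<tau>\<close>.\<close>

lemma first_order_mult:
  fixes A B a b :: real
  assumes "\<bar>A - 1 - a\<bar> \<le> C * \<tau>\<^sup>2" "\<bar>a\<bar> \<le> c * \<tau>" "\<bar>B - 1 - b\<bar> \<le> D * \<tau>\<^sup>2" "\<bar>b\<bar> \<le> d * \<tau>"
    and "0 \<le> \<tau>" "\<tau> \<le> 1" "0 \<le> C" "0 \<le> D" "0 \<le> c" "0 \<le> d"
  shows "\<bar>A * B - 1 - (a + b)\<bar> \<le> (C * (1 + d + D) + (1 + c) * D + c * d) * \<tau>\<^sup>2"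
proof -
  have t: "\<tau>\<^sup>2 \<le> 1" using assms by (simp add: power_le_one)
  have "D * \<tau>\<^sup>2 \<le> D" "d * \<tau> \<le> d" "c * \<tau> \<le> c"
    using assms t by (simp_all add: mult_left_le)
  hence B: "\<bar>B\<bar> \<le> 1 + d + D" and a: "\<bar>1 + a\<bar> \<le> 1 + c"
    using assms(2-4) by linarith+
  have "A * B - 1 - (a + b) = (A - 1 - a) * B + (1 + a) * (B - 1 - b) + a * b"
    by (simp add: algebra_simps)
  hence "\<bar>A * B - 1 - (a + b)\<bar> \<le> \<bar>A - 1 - a\<bar> * \<bar>B\<bar> + \<bar>1 + a\<bar> * \<bar>B - 1 - b\<bar> + \<bar>a\<bar> * \<bar>b\<bar>"
    unfolding abs_mult [symmetric] by linarith
  also have "\<dots> \<le> (C * \<tau>\<^sup>2) * (1 + d + D) + (1 + c) * (D * \<tau>\<^sup>2) + (c * \<tau>) * (d * \<tau>)"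
    using assms by (intro add_mono mult_mono B a) auto
  also have "\<dots> = (C * (1 + d + D) + (1 + c) * D + c * d) * \<tau>\<^sup>2"
    by (simp add: algebra_simps power2_eq_square)
  finally show ?thesis .
qed

lemma power_first_order:
  "\<exists>C\<ge>0. \<forall>(y::real) \<tau>. \<bar>y\<bar> \<le> \<tau> \<and> \<tau> \<le> 1 \<longrightarrow> \<bar>(1 + y) ^ k - 1 - real k * y\<bar> \<le> C * \<tau>\<^sup>2"
proof (induction k)
  case (Suc k)
  then obtain C where C: "C \<ge> 0"
    "\<And>y \<tau> :: real. \<bar>y\<bar> \<le> \<tau> \<Longrightarrow> \<tau> \<le> 1 \<Longrightarrow> \<bar>(1 + y) ^ k - 1 - real k * y\<bar> \<le> C * \<tau>\<^sup>2"
    by blast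
  show ?case
  \<comment> \<open>The constant of \<open>first_order_mult\<close> for the factor
    \<open>1 + y\<close>, which has no remainder: \<open>D = 0\<close>, \<open>d = 1\<close>,
    \<open>c = real k\<close>.\<close>
  proof (intro exI[of _ "C * (1 + 1 + 0) + (1 + real k) * 0 + real k * 1"] conjI allI impI)
    fix y \<tau> :: real assume "\<bar>y\<bar> \<le> \<tau> \<and> \<tau> \<le> 1"
    hence "\<bar>(1 + y) ^ k * (1 + y) - 1 - (real k * y + y)\<bar>
        \<le> (C * (1 + 1 + 0) + (1 + real k) * 0 + real k * 1) * \<tau>\<^sup>2"
      using C by (intro first_order_mult) (auto simp: abs_mult mult_left_mono)
    thus "\<bar>(1 + y) ^ Suc k - 1 - real (Suc k) * y\<bar>
        \<le> (C * (1 + 1 + 0) + (1 + real k) * 0 + real k * 1) * \<tau>\<^sup>2"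
      by (simp add: algebra_simps)
  qed (use C in auto)
qed (auto intro: exI[of _ 0])

lemma monomial_first_order:
  fixes \<alpha> :: "nat \<Rightarrow> nat"
  shows "\<exists>C\<ge>0. \<forall>(y::nat \<Rightarrow> real) \<tau>. (\<forall>i<l. \<bar>y i\<bar> \<le> \<tau>) \<and> 0 \<le> \<tau> \<and> \<tau> \<le> 1 \<longrightarrow>
    \<bar>(\<Prod>i<l. (1 + y i) ^ \<alpha> i) - 1 - (\<Sum>i<l. real (\<alpha> i) * y i)\<bar> \<le> C * \<tau>\<^sup>2"
proof (induction l)
  case (Suc l)
  then obtain C where C: "C \<ge> 0"
    "\<And>y \<tau>. (\<forall>i<l. \<bar>y i\<bar> \<le> \<tau>) \<Longrightarrow> 0 \<le> \<tau> \<Longrightarrow> \<tau> \<le> 1 \<Longrightarrow>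
       \<bar>(\<Prod>i<l. (1 + y i) ^ \<alpha> i) - 1 - (\<Sum>i<l. real (\<alpha> i) * y i)\<bar> \<le> C * \<tau>\<^sup>2"
    by blast
  obtain D where D: "D \<ge> 0"
    "\<And>y \<tau> :: real. \<bar>y\<bar> \<le> \<tau> \<Longrightarrow> \<tau> \<le> 1 \<Longrightarrow> \<bar>(1 + y) ^ \<alpha> l - 1 - real (\<alpha> l) * y\<bar> \<le> D * \<tau>\<^sup>2"
    using power_first_order[of "\<alpha> l"] by blast
  define c where "c = (\<Sum>i<l. real (\<alpha> i))"
  define d where "d = real (\<alpha> l)"
  have c0: "c \<ge> 0" unfolding c_def by (intro sum_nonneg) auto
  show ?case
  proof (intro exI[of _ "C * (1 + d + D) + (1 + c) * D + c * d"] conjI allI impI)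
    fix y :: "nat \<Rightarrow> real" and \<tau> assume *: "(\<forall>i<Suc l. \<bar>y i\<bar> \<le> \<tau>) \<and> 0 \<le> \<tau> \<and> \<tau> \<le> 1"
    have "\<bar>\<Sum>i<l. real (\<alpha> i) * y i\<bar> \<le> (\<Sum>i<l. real (\<alpha> i) * \<tau>)"
      by (rule order.trans[OF sum_abs sum_mono]) (use * in \<open>auto simp: abs_mult intro!: mult_left_mono\<close>)
    also have "\<dots> = c * \<tau>" by (simp add: c_def sum_distrib_right)
    finally have "\<bar>(\<Prod>i<l. (1 + y i) ^ \<alpha> i) * (1 + y l) ^ \<alpha> l - 1 - ((\<Sum>i<l. real (\<alpha> i) * y i) + real (\<alpha> l) * y l)\<bar>
        \<le> (C * (1 + d + D) + (1 + c) * D + c * d) * \<tau>\<^sup>2"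
      using * C D c0 by (intro first_order_mult) (auto simp: abs_mult d_def mult_left_mono)
    thus "\<bar>(\<Prod>i<Suc l. (1 + y i) ^ \<alpha> i) - 1 - (\<Sum>i<Suc l. real (\<alpha> i) * y i)\<bar>
        \<le> (C * (1 + d + D) + (1 + c) * D + c * d) * \<tau>\<^sup>2"
      by simp
  qed (use C D c0 in \<open>auto simp: d_def\<close>)
qed (auto intro: exI[of _ 0])

text \<open>The Euler operator multiplies a monomial by its exponent at \<open>k\<close>. In this
  form the truncated exponent \<open>\<alpha> k - 1\<close> disappears; for
  \<open>\<alpha> k = 0\<close> both sides vanish.\<close>

lemma mult_mpoly_deriv_eval:
  assumes "k < l"
  shows "t k * mpoly_deriv_eval l Q k t = (\<Sum>\<alpha> | Q \<alpha> \<noteq> 0. Q \<alpha> * real (\<alpha> k) * (\<Prod>i<l. t i ^ \<alpha> i))"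
  unfolding mpoly_deriv_eval_def sum_distrib_left
proof (intro sum.cong refl)
  fix \<alpha> :: "nat \<Rightarrow> nat"
  have "(\<Prod>i<l. t i ^ \<alpha> i) = t k ^ \<alpha> k * (\<Prod>i\<in>{..<l} - {k}. t i ^ \<alpha> i)"
    by (rule prod.remove) (use assms in auto)
  moreover have "real (\<alpha> k) * t k ^ \<alpha> k = real (\<alpha> k) * (t k * t k ^ (\<alpha> k - 1))"
    by (cases "\<alpha> k") auto
  ultimately show "t k * (Q \<alpha> * real (\<alpha> k) * t k ^ (\<alpha> k - 1) * (\<Prod>i\<in>{..<l} - {k}. t i ^ \<alpha> i))
      = Q \<alpha> * real (\<alpha> k) * (\<Prod>i<l. t i ^ \<alpha> i)"
    by (cases "\<alpha> k = 0") (simp_all add: mult_ac)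
qed

text \<open>In relative deviations \<open>y\<close> every monomial is multiplied by a factor
  depending on \<open>y\<close> only, so its error is proportional to its own value. As all
  monomials are nonnegative, the total is controlled by the first order quantity on the right
  instead of second derivatives.\<close>

lemma mpoly_eval_first_order:
  assumes fin: "finite {\<alpha>. Q \<alpha> \<noteq> 0}" and Q: "\<And>\<alpha>. Q \<alpha> \<ge> 0"
  shows "\<exists>C\<ge>0. \<forall>t y \<tau>. (\<forall>i<l. t i \<ge> 0 \<and> \<bar>y i\<bar> \<le> \<tau>) \<and> 0 \<le> \<tau> \<and> \<tau> \<le> 1 \<longrightarrow>
     \<bar>mpoly_eval l Q (\<lambda>i. t i * (1 + y i)) - mpoly_eval l Q t
        - (\<Sum>i<l. mpoly_deriv_eval l Q i t * (t i * y i))\<bar>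
     \<le> C * \<tau>\<^sup>2 * (\<Sum>i<l. t i * mpoly_deriv_eval l Q i t)"
proof -
  have "\<forall>\<alpha>. \<exists>C. 0 \<le> C \<and> (\<forall>(y::nat \<Rightarrow> real) \<tau>. (\<forall>i<l. \<bar>y i\<bar> \<le> \<tau>) \<and> 0 \<le> \<tau> \<and> \<tau> \<le> 1 \<longrightarrow>
    \<bar>(\<Prod>i<l. (1 + y i) ^ \<alpha> i) - 1 - (\<Sum>i<l. real (\<alpha> i) * y i)\<bar> \<le> C * \<tau>\<^sup>2)"
    by (intro allI monomial_first_order)
  from choice[OF this] obtain c where
    c': "\<forall>\<alpha>. 0 \<le> c \<alpha> \<and> (\<forall>(y::nat \<Rightarrow> real) \<tau>. (\<forall>i<l. \<bar>y i\<bar> \<le> \<tau>) \<and> 0 \<le> \<tau> \<and> \<tau> \<le> 1 \<longrightarrow>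
    \<bar>(\<Prod>i<l. (1 + y i) ^ \<alpha> i) - 1 - (\<Sum>i<l. real (\<alpha> i) * y i)\<bar> \<le> c \<alpha> * \<tau>\<^sup>2)" ..
  have c: "c \<alpha> \<ge> 0"
    "(\<forall>i<l. \<bar>y i\<bar> \<le> \<tau>) \<Longrightarrow> 0 \<le> \<tau> \<Longrightarrow> \<tau> \<le> 1 \<Longrightarrow>
      \<bar>(\<Prod>i<l. (1 + y i) ^ \<alpha> i) - 1 - (\<Sum>i<l. real (\<alpha> i) * y i)\<bar> \<le> c \<alpha> * \<tau>\<^sup>2" for \<alpha> y \<tau>
    using c' by simp_all
  define S where "S = {\<alpha>. Q \<alpha> \<noteq> 0}"
  define C where "C = (\<Sum>\<alpha>\<in>S. c \<alpha>)"
  have cC: "c \<alpha> \<le> C" if "\<alpha> \<in> S" for \<alpha>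
    unfolding C_def using that fin c(1) by (intro member_le_sum) (auto simp: S_def)
  have C0: "C \<ge> 0" unfolding C_def by (intro sum_nonneg c)
  show ?thesis
  proof (intro exI[of _ C] conjI allI impI C0)
    fix t y :: "nat \<Rightarrow> real" and \<tau> :: real
    assume *: "(\<forall>i<l. t i \<ge> 0 \<and> \<bar>y i\<bar> \<le> \<tau>) \<and> 0 \<le> \<tau> \<and> \<tau> \<le> 1"
    define T where "T = (\<lambda>\<alpha>. \<Prod>i<l. t i ^ \<alpha> i)"
    have T0: "T \<alpha> \<ge> 0" for \<alpha> unfolding T_def using * by (intro prod_nonneg) auto
    have lin: "(\<Sum>i<l. mpoly_deriv_eval l Q i t * (t i * y i)) = (\<Sum>\<alpha>\<in>S. Q \<alpha> * T \<alpha> * (\<Sum>i<l. real (\<alpha> i) * y i))"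
    proof -
      have "(\<Sum>i<l. mpoly_deriv_eval l Q i t * (t i * y i)) = (\<Sum>i<l. (t i * mpoly_deriv_eval l Q i t) * y i)"
        by (intro sum.cong) auto
      also have "\<dots> = (\<Sum>i<l. \<Sum>\<alpha>\<in>S. Q \<alpha> * T \<alpha> * (real (\<alpha> i) * y i))"
        by (intro sum.cong refl) (simp add: mult_mpoly_deriv_eval sum_distrib_left sum_distrib_right S_def T_def mult_ac)
      also have "\<dots> = (\<Sum>\<alpha>\<in>S. \<Sum>i<l. Q \<alpha> * T \<alpha> * (real (\<alpha> i) * y i))" by (rule sum.swap)
      finally show ?thesis by (simp add: sum_distrib_left)
    qed
    have euler: "(\<Sum>i<l. t i * mpoly_deriv_eval l Q i t) = (\<Sum>\<alpha>\<in>S. Q \<alpha> * T \<alpha> * (\<Sum>i<l. real (\<alpha> i)))"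
    proof -
      have "(\<Sum>i<l. t i * mpoly_deriv_eval l Q i t) = (\<Sum>i<l. \<Sum>\<alpha>\<in>S. Q \<alpha> * T \<alpha> * real (\<alpha> i))"
        by (intro sum.cong refl) (simp add: mult_mpoly_deriv_eval S_def T_def mult_ac)
      also have "\<dots> = (\<Sum>\<alpha>\<in>S. \<Sum>i<l. Q \<alpha> * T \<alpha> * real (\<alpha> i))" by (rule sum.swap)
      finally show ?thesis by (simp add: sum_distrib_left)
    qed
    have "mpoly_eval l Q (\<lambda>i. t i * (1 + y i)) - mpoly_eval l Q t
        - (\<Sum>i<l. mpoly_deriv_eval l Q i t * (t i * y i))
      = (\<Sum>\<alpha>\<in>S. Q \<alpha> * T \<alpha> * ((\<Prod>i<l. (1 + y i) ^ \<alpha> i) - 1 - (\<Sum>i<l. real (\<alpha> i) * y i)))"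
    proof -
      have "(\<Prod>i<l. (t i * (1 + y i)) ^ \<alpha> i) = T \<alpha> * (\<Prod>i<l. (1 + y i) ^ \<alpha> i)" for \<alpha>
        by (simp add: T_def power_mult_distrib prod.distrib)
      thus ?thesis
        unfolding lin mpoly_eval_def S_def[symmetric] sum_subtractf[symmetric] T_def[symmetric]
        by (intro sum.cong refl) (simp only: T_def right_diff_distrib mult.assoc mult_1_right)
    qed
    also have "\<bar>\<dots>\<bar> \<le> (\<Sum>\<alpha>\<in>S. C * \<tau>\<^sup>2 * (Q \<alpha> * T \<alpha> * (\<Sum>i<l. real (\<alpha> i))))"
    proof (rule order.trans[OF sum_abs sum_mono])
      fix \<alpha> assume \<alpha>: "\<alpha> \<in> S"
      define R where "R = (\<Prod>i<l. (1 + y i) ^ \<alpha> i) - 1 - (\<Sum>i<l. real (\<alpha> i) * y i)"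
      have "\<bar>R\<bar> \<le> C * \<tau>\<^sup>2 * (\<Sum>i<l. real (\<alpha> i))"
      \<comment> \<open>A constant monomial has no error, and any other has total degree at least 1.
        The error can thus be weighted by the degree, which is the weight in Euler's identity
        \<open>euler\<close>.\<close>
      proof (cases "\<forall>i<l. \<alpha> i = 0")
        case True
        thus ?thesis by (simp add: R_def)
      next
        case False
        then obtain i where i: "i < l" "\<alpha> i \<ge> 1" by (auto simp: Suc_le_eq)
        have "1 \<le> real (\<alpha> i)" using i by simp
        also have "\<dots> \<le> (\<Sum>i<l. real (\<alpha> i))" using i by (intro member_le_sum) auto
        finally have ge1: "1 \<le> (\<Sum>i<l. real (\<alpha> i))" .
        have "\<bar>R\<bar> \<le> c \<alpha> * \<tau>\<^sup>2" unfolding R_def by (rule c(2)) (use * in auto)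
        also have "\<dots> \<le> C * \<tau>\<^sup>2 * 1" using cC[OF \<alpha>] by (simp add: mult_right_mono)
        also have "\<dots> \<le> C * \<tau>\<^sup>2 * (\<Sum>i<l. real (\<alpha> i))" using ge1 C0 by (intro mult_left_mono) auto
        finally show ?thesis .
      qed
      hence "Q \<alpha> * T \<alpha> * \<bar>R\<bar> \<le> Q \<alpha> * T \<alpha> * (C * \<tau>\<^sup>2 * (\<Sum>i<l. real (\<alpha> i)))"
        using Q T0 by (intro mult_left_mono) auto
      thus "\<bar>Q \<alpha> * T \<alpha> * ((\<Prod>i<l. (1 + y i) ^ \<alpha> i) - 1 - (\<Sum>i<l. real (\<alpha> i) * y i))\<bar>
         \<le> C * \<tau>\<^sup>2 * (Q \<alpha> * T \<alpha> * (\<Sum>i<l. real (\<alpha> i)))"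
        using Q[of \<alpha>] T0[of \<alpha>] unfolding R_def[symmetric] by (simp add: abs_mult mult_ac)
    qed
    also have "\<dots> = C * \<tau>\<^sup>2 * (\<Sum>i<l. t i * mpoly_deriv_eval l Q i t)"
      unfolding euler by (simp add: sum_distrib_left)
    finally show "\<bar>mpoly_eval l Q (\<lambda>i. t i * (1 + y i)) - mpoly_eval l Q t
        - (\<Sum>i<l. mpoly_deriv_eval l Q i t * (t i * y i))\<bar>
       \<le> C * \<tau>\<^sup>2 * (\<Sum>i<l. t i * mpoly_deriv_eval l Q i t)" .
  qed
qed

lemma mpoly_deriv_eval_nonneg:
  assumes "\<And>\<alpha>. Q \<alpha> \<ge> 0" "\<And>i. i < l \<Longrightarrow> t i \<ge> 0" "k < l"
  shows "mpoly_deriv_eval l Q k t \<ge> 0"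
  unfolding mpoly_deriv_eval_def using assms
  by (intro sum_nonneg mult_nonneg_nonneg prod_nonneg) auto

text \<open>Nonnegative coefficients exclude cancellation, so a variable that really occurs in
  \<open>Q\<close> has a positive derivative. This makes \<open>B_Q\<close> nonzero and division by
  it legitimate.\<close>

lemma mpoly_deriv_eval_pos:
  assumes "finite {\<alpha>. Q \<alpha> \<noteq> 0}" "\<And>\<alpha>. Q \<alpha> \<ge> 0" "\<And>i. i < l \<Longrightarrow> t i > 0" "k < l" "Q \<beta> \<noteq> 0" "\<beta> k > 0"
  shows "mpoly_deriv_eval l Q k t > 0"
  unfolding mpoly_deriv_eval_def
proof (rule sum_pos2[of _ \<beta>])
  have "Q \<beta> > 0" using assms(2)[of \<beta>] assms(5) by simp
  thus "0 < Q \<beta> * real (\<beta> k) * t k ^ (\<beta> k - 1) * (\<Prod>i\<in>{..<l} - {k}. t i ^ \<beta> i)"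
    using assms by (intro mult_pos_pos prod_pos) auto
  show "0 \<le> Q \<alpha> * real (\<alpha> k) * t k ^ (\<alpha> k - 1) * (\<Prod>i\<in>{..<l} - {k}. t i ^ \<alpha> i)" for \<alpha>
    using assms(2)[of \<alpha>] assms(3,4) by (intro mult_nonneg_nonneg prod_nonneg) (auto intro: less_imp_le)
qed (use assms in auto)

lemma sigma2_at_top:
  fixes g :: "nat \<Rightarrow> real"
  assumes "\<not> summable (\<lambda>p. if prime p then (g p)\<^sup>2 / real p else 0)"
  shows "filterlim (\<lambda>N. sigma2 g (real N)) at_top sequentially"
proof -
  define f where "f = (\<lambda>p. if prime p then (g p)\<^sup>2 / real p else 0)"
  have f0: "f p \<ge> 0" for p by (simp add: f_def)
  have sigma2: "(\<Sum>p<n. f p) / 2 \<le> sigma2 g (real N)" if "n \<le> N" for n N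
  proof -
    have fin: "finite {p. prime p \<and> p \<le> N}" by (rule finite_subset[of _ "{..N}"]) auto
    have "(\<Sum>p<n. f p) \<le> (\<Sum>p\<in>{..N}. f p)"
      using that f0 by (intro sum_mono2) auto
    also have "\<dots> = (\<Sum>p | prime p \<and> p \<le> N. (g p)\<^sup>2 / real p)"
      unfolding f_def by (subst sum.inter_filter [symmetric]) (auto intro!: sum.cong)
    finally have "(\<Sum>p<n. f p) / 2 \<le> (\<Sum>p | prime p \<and> p \<le> N. (g p)\<^sup>2 / real p * (1 / 2))"
      unfolding sum_distrib_right [symmetric] by simp
    also have "\<dots> \<le> sigma2 g (real N)"
      unfolding sigma2_def kappa_def of_nat_le_iff power2_eq_square
    proof (intro sum_mono mult_left_mono)
      fix p :: nat assume "p \<in> {p. prime p \<and> p \<le> N}"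
      hence "p \<ge> 2" by (auto simp: prime_ge_2_nat)
      thus "1 / 2 \<le> 1 - 1 / real p" by (auto simp: divide_simps)
    qed auto
    finally show ?thesis .
  qed
  show ?thesis unfolding filterlim_at_top
  proof
    fix Z :: real
    have "\<not> (\<forall>n. (\<Sum>p<n. f p) \<le> 2 * Z)"
      using assms f0 summableI_nonneg_bounded[of f "2 * Z"] unfolding f_def by blast
    then obtain n where n: "(\<Sum>p<n. f p) > 2 * Z" by (auto simp: not_le)
    show "eventually (\<lambda>N. Z \<le> sigma2 g (real N)) sequentially"
      using eventually_ge_at_top[of n]
    proof eventually_elim
      case (elim N)
      from sigma2[OF elim] n show ?case by linarith
    qed
  qed
qed

section \<open>The limit law for polynomials\<close>

lemma mu_of_nat: "mu g (real N) = (\<Sum>p | prime p \<and> p \<le> N. g p / real p)"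
  by (simp add: mu_def)

lemma kappa_of_nat:
  "kappa f g (real N) = (\<Sum>p | prime p \<and> p \<le> N. f p * g p / real p * (1 - 1 / real p))"
  by (simp add: kappa_def)

section \<open>Comparing means, variances and the normalization B_Q\<close>

lemma kappa_nonneg:
  assumes "\<And>p. prime p \<Longrightarrow> f p \<ge> 0" "\<And>p. prime p \<Longrightarrow> g p \<ge> 0"
  shows "kappa f g x \<ge> 0"
  unfolding kappa_def using assms
  by (intro sum_nonneg mult_nonneg_nonneg divide_nonneg_nonneg) (auto dest: prime_ge_2_nat)

lemma mu_nonneg:
  assumes "\<And>p. prime p \<Longrightarrow> g p \<ge> 0"
  shows "mu g x \<ge> 0"
  unfolding mu_def using assms by (intro sum_nonneg) auto

lemma sigma2_le_mu:
  assumes "\<And>p. prime p \<Longrightarrow> g p \<ge> 0" "\<And>p. prime p \<Longrightarrow> g p \<le> G"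
  shows "sigma2 g x \<le> G * mu g x"
  unfolding sigma2_def kappa_def mu_def sum_distrib_left
proof (intro sum_mono)
  fix p :: nat assume "p \<in> {p. prime p \<and> real p \<le> x}"
  hence p: "prime p" "p \<ge> 2" by (auto simp: prime_ge_2_nat)
  have "g p * g p / real p * (1 - 1 / real p) \<le> G * g p / real p * 1"
    using assms[OF p(1)] p(2) by (intro mult_mono divide_right_mono) auto
  thus "g p * g p / real p * (1 - 1 / real p) \<le> G * (g p / real p)" by simp
qed

text \<open>All terms of the double sum are nonnegative, so its diagonal term at \<open>i\<close>
  alone is a lower bound. The resulting estimate of \<open>D i\<close> relative to
  \<open>B_Q\<close> makes the values of the normalized function at primes small and also controls
  the Taylor remainder.\<close>

lemma mpoly_deriv_sigma_le_B_Q: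
  fixes x :: real
  assumes Q: "\<And>\<alpha>. Q \<alpha> \<ge> 0" and g: "\<And>j p. j < l \<Longrightarrow> prime p \<Longrightarrow> g j p \<ge> 0" and i: "i < l"
  defines "D \<equiv> (\<lambda>i. mpoly_deriv_eval l Q i (\<lambda>k. mu (g k) x))"
  shows "D i * sqrt (sigma2 (g i) x) \<le> B_Q l Q g x"
proof -
  have D: "D j \<ge> 0" if "j < l" for j
    unfolding D_def using Q that by (intro mpoly_deriv_eval_nonneg mu_nonneg g) auto
  have nn: "D a * D b * kappa (g a) (g b) x \<ge> 0" if "a < l" "b < l" for a b
    using D that by (intro mult_nonneg_nonneg kappa_nonneg g) auto
  have "D i * D i * kappa (g i) (g i) x \<le> (\<Sum>b<l. D i * D b * kappa (g i) (g b) x)"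
    using i nn by (intro member_le_sum[of i "{..<l}" "\<lambda>b. D i * D b * kappa (g i) (g b) x"]) auto
  also have "\<dots> \<le> (\<Sum>a<l. \<Sum>b<l. D a * D b * kappa (g a) (g b) x)"
    using i nn by (intro member_le_sum[of i "{..<l}" "\<lambda>a. \<Sum>b<l. D a * D b * kappa (g a) (g b) x"] sum_nonneg) auto
  finally have "sqrt ((D i)\<^sup>2 * sigma2 (g i) x) \<le> B_Q l Q g x"
    unfolding B_Q_def D_def sigma2_def power2_eq_square by (rule real_sqrt_le_mono)
  thus ?thesis using D[OF i] by (simp add: real_sqrt_mult)
qed

text \<open>The quadratic form is the variance of the single strongly additive function with prime
  values \<open>\<Sum>i<l. D i * g i p\<close>, so dividing by \<open>B_Q\<close> normalizes that
  variance to 1.\<close>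

lemma B_Q_squared:
  assumes Q: "\<And>\<alpha>. Q \<alpha> \<ge> 0" and g: "\<And>j p. j < l \<Longrightarrow> prime p \<Longrightarrow> g j p \<ge> 0"
  defines "D \<equiv> (\<lambda>x i. mpoly_deriv_eval l Q i (\<lambda>k. mu (g k) x))"
  shows "(B_Q l Q g (real N))\<^sup>2 =
    (\<Sum>p | prime p \<and> p \<le> N. (\<Sum>i<l. D (real N) i * g i p)\<^sup>2 / real p * (1 - 1 / real p))"
proof -
  let ?D = "D (real N)"
  let ?P = "{p. prime p \<and> p \<le> N}"
  have D: "?D j \<ge> 0" if "j < l" for j
    unfolding D_def using Q that by (intro mpoly_deriv_eval_nonneg mu_nonneg g) auto
  have "(\<Sum>i<l. \<Sum>j<l. ?D i * ?D j * kappa (g i) (g j) (real N)) \<ge> 0"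
    using D by (intro sum_nonneg mult_nonneg_nonneg kappa_nonneg g) auto
  hence "(B_Q l Q g (real N))\<^sup>2 = (\<Sum>i<l. \<Sum>j<l. ?D i * ?D j * kappa (g i) (g j) (real N))"
    unfolding B_Q_def D_def by simp
  also have "\<dots> = (\<Sum>i<l. \<Sum>j<l. \<Sum>p\<in>?P. (?D i * g i p) * (?D j * g j p) / real p * (1 - 1 / real p))"
    unfolding kappa_of_nat sum_distrib_left by (intro sum.cong refl) simp
  also have "\<dots> = (\<Sum>i<l. \<Sum>p\<in>?P. \<Sum>j<l. (?D i * g i p) * (?D j * g j p) / real p * (1 - 1 / real p))"
    by (intro sum.cong refl sum.swap)
  also have "\<dots> = (\<Sum>p\<in>?P. \<Sum>i<l. \<Sum>j<l. (?D i * g i p) * (?D j * g j p) / real p * (1 - 1 / real p))"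
    by (rule sum.swap)
  also have "\<dots> = (\<Sum>p\<in>?P. (\<Sum>i<l. ?D i * g i p)\<^sup>2 / real p * (1 - 1 / real p))"
    unfolding power2_eq_square sum_product unfolding sum_divide_distrib sum_distrib_right ..
  finally show ?thesis .
qed

text \<open>Chebyshev's inequality applied to \<open>turan_kubilius_bounded\<close>.\<close>

lemma deviation_probability_le:
  fixes g :: "nat \<Rightarrow> real" and G R :: real
  assumes g: "strongly_additive g" "\<And>p. prime p \<Longrightarrow> 0 \<le> g p \<and> g p \<le> G" and R: "R > 0"
  shows "real (card {n\<in>{1..N}. \<bar>g n - mu g (real N)\<bar> > R}) \<le> 3 * G * mu g (real N) / R\<^sup>2 * real N"
proof -
  have G: "G \<ge> 0" using g(2)[of 2] by simp
  have "R\<^sup>2 * real (card {n\<in>{1..N}. \<bar>g n - mu g (real N)\<bar> > R}) 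
      = (\<Sum>n\<in>{n\<in>{1..N}. \<bar>g n - mu g (real N)\<bar> > R}. R\<^sup>2)" by simp
  also have "\<dots> \<le> (\<Sum>n\<in>{n\<in>{1..N}. \<bar>g n - mu g (real N)\<bar> > R}. (g n - mu g (real N))\<^sup>2)"
    using R by (intro sum_mono) (auto simp: abs_le_square_iff[symmetric])
  also have "\<dots> \<le> (\<Sum>n=1..N. (g n - mu g (real N))\<^sup>2)"
    by (intro sum_mono2) auto
  also have "\<dots> = (\<Sum>n=1..N. ((\<Sum>p | prime p \<and> p \<le> N. if p dvd n then g p else 0) - mu g (real N))\<^sup>2)"
    by (intro sum.cong refl) (simp add: strongly_additive_eq_sum_primes[OF g(1), of _ N])
  also have "\<dots> \<le> 3 * G * mu g (real N) * real N"
    unfolding mu_of_nat by (rule turan_kubilius_bounded) (use g G in auto)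
  finally show ?thesis using R by (simp add: field_simps)
qed

theorem polynomial_erdos_kac_nat:
  fixes l :: nat and Q :: "(nat \<Rightarrow> nat) \<Rightarrow> real" and g :: "nat \<Rightarrow> nat \<Rightarrow> real" and u :: real
  assumes Q_finite: "finite {\<alpha>. Q \<alpha> \<noteq> 0}"
    and Q_nonneg: "\<And>\<alpha>. Q \<alpha> \<ge> 0"
    and Q_nonconst: "Q \<beta> \<noteq> 0" "i\<^sub>0 < l" "\<beta> i\<^sub>0 > 0"
    and g_sadd: "\<And>j. j < l \<Longrightarrow> strongly_additive (g j)"
    and g_bdd: "\<And>j p. j < l \<Longrightarrow> prime p \<Longrightarrow> 0 \<le> g j p \<and> g j p \<le> G"
    and v: "filterlim v at_top sequentially" and ab: "a > 0" "b > 0"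
    and mu_v: "eventually (\<lambda>N. \<forall>j<l. a * v N \<le> mu (g j) (real N) \<and> mu (g j) (real N) \<le> b * v N) sequentially"
    and sigma2_v: "eventually (\<lambda>N. \<forall>j<l. a * v N \<le> sigma2 (g j) (real N)) sequentially"
  shows "(\<lambda>N. real (card {n\<in>{1..N}. mpoly_eval l Q (\<lambda>i. g i n) < A_Q l Q g (real N) + u * B_Q l Q g (real N)}) / real N)
          \<longlonglongrightarrow> 1 / sqrt (2 * pi) * (LBINT t:{..u}. exp (- t\<^sup>2 / 2))"
proof -
  define m where "m = (\<lambda>N i. mu (g i) (real N))"
  define D where "D = (\<lambda>N i. mpoly_deriv_eval l Q i (m N))"
  define B where "B = (\<lambda>N. B_Q l Q g (real N))"
  define P where "P = (\<lambda>N::nat. {p. prime p \<and> p \<le> N})"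
  have P: "P N = {p. prime p \<and> p \<le> N}" for N by (simp add: P_def)
  have l: "l > 0" using Q_nonconst by simp
  have G0: "G \<ge> 0" using g_bdd[OF l, of 2] by simp
  \<comment> \<open>A strictly positive bound, so that \<open>\<epsilon>\<close> below is
    positive.\<close>
  define G' where "G' = G + 1"
  have G': "G' > 0" "G \<le> G'" using G0 by (auto simp: G'_def)
  have g0: "g j p \<ge> 0" if "j < l" "prime p" for j p using g_bdd that by auto
  have m0: "m N j \<ge> 0" if "j < l" for N j
    unfolding m_def using that by (intro mu_nonneg g0)
  have D0: "D N j \<ge> 0" if "j < l" for N j
    unfolding D_def using that by (intro mpoly_deriv_eval_nonneg Q_nonneg m0)
  have v_gt: "eventually (\<lambda>N. v N > c) sequentially" for c
    using v by (simp add: filterlim_at_top_dense)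

  have DB: "eventually (\<lambda>N. B N > 0 \<and> (\<forall>j<l. D N j / B N \<le> 1 / sqrt (a * v N))) sequentially"
    using mu_v sigma2_v v_gt[of 0]
  proof eventually_elim
    case (elim N)
    have av: "a * v N > 0" using elim ab by simp
    have le: "D N j * sqrt (a * v N) \<le> B N" if j: "j < l" for j
    proof -
      have "D N j * sqrt (a * v N) \<le> D N j * sqrt (sigma2 (g j) (real N))"
        using elim j D0 by (intro mult_left_mono real_sqrt_le_mono) auto
      also have "\<dots> \<le> B N"
        unfolding D_def B_def m_def by (rule mpoly_deriv_sigma_le_B_Q[OF Q_nonneg g0 j])
      finally show ?thesis .
    qed
    have "m N j > 0" if "j < l" for j
      using av elim that by (force simp: m_def)
    hence "D N i\<^sub>0 > 0"
      unfolding D_def by (intro mpoly_deriv_eval_pos[OF Q_finite Q_nonneg _ Q_nonconst(2,1,3)])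
    hence "0 < D N i\<^sub>0 * sqrt (a * v N)" using av by simp
    hence "B N > 0" using le[OF Q_nonconst(2)] by linarith
    moreover have "D N j / B N \<le> 1 / sqrt (a * v N)" if "j < l" for j
      using le[OF that] \<open>B N > 0\<close> av by (simp add: divide_simps)
    ultimately show ?case by blast
  qed

  define h where "h = (\<lambda>N p. (\<Sum>i<l. D N i * g i p) / B N)"
  \<comment> \<open>Each of the \<open>l\<close> summands of \<open>h N p\<close> is at most
    \<open>G' / sqrt (a * v N)\<close>. The mean of \<open>h N\<close> is at most
    \<open>l * b * v N / sqrt (a * v N)\<close>, and \<open>C\<close> is chosen to make this equal
    to \<open>C / \<epsilon> N\<close>.\<close>
  define \<epsilon> where "\<epsilon> = (\<lambda>N. real l * G' / sqrt (a * v N))"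
  define C where "C = (real l)\<^sup>2 * b * G' / a"
  have mean_h: "(\<Sum>p\<in>P N. h N p / real p) = (\<Sum>i<l. D N i / B N * m N i)" for N
  proof -
    have "(\<Sum>p\<in>P N. h N p / real p) = (\<Sum>p\<in>P N. \<Sum>i<l. D N i / B N * (g i p / real p))"
      unfolding h_def sum_divide_distrib by (intro sum.cong refl) simp
    also have "\<dots> = (\<Sum>i<l. \<Sum>p\<in>P N. D N i / B N * (g i p / real p))" by (rule sum.swap)
    finally show ?thesis by (simp add: m_def mu_of_nat P_def sum_distrib_left)
  qed
  have char_h: "(\<lambda>N. (\<Sum>n=1..N. iexp (t * ((\<Sum>p\<in>P N. if p dvd n then h N p else 0) - (\<Sum>p\<in>P N. h N p / real p)))) / of_nat N)
          \<longlonglongrightarrow> of_real (exp (- t\<^sup>2 / 2))" for t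
    unfolding P
  proof (rule erdos_kac_char_tendsto[where h = h and \<epsilon> = \<epsilon> and C = C], unfold P[symmetric])
    show "C > 0" using l ab G' by (simp add: C_def)
    show "eventually (\<lambda>N. 0 < \<epsilon> N) sequentially"
      using v_gt[of 0] by eventually_elim (use l ab G' in \<open>simp add: \<epsilon>_def\<close>)
    have "filterlim (\<lambda>N. sqrt (a * v N)) at_top sequentially"
      by (intro filterlim_compose[OF sqrt_at_top] filterlim_tendsto_pos_mult_at_top[OF tendsto_const ab(1) v])
    thus "\<epsilon> \<longlonglongrightarrow> 0" unfolding \<epsilon>_def
      by (intro tendsto_divide_0[OF tendsto_const] filterlim_at_top_imp_at_infinity)
    show "eventually (\<lambda>N. \<forall>p\<in>P N. 0 \<le> h N p \<and> h N p \<le> \<epsilon> N) sequentially"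
      using DB v_gt[of 0]
    proof eventually_elim
      case (elim N)
      show ?case
      proof (intro ballI conjI)
        fix p assume p: "p \<in> P N"
        show "h N p \<ge> 0"
          unfolding h_def using elim D0 g0 p by (intro divide_nonneg_nonneg sum_nonneg mult_nonneg_nonneg) (auto simp: P_def)
        have "h N p = (\<Sum>i<l. D N i / B N * g i p)" by (simp add: h_def sum_divide_distrib)
        also have "\<dots> \<le> (\<Sum>i<l. 1 / sqrt (a * v N) * G')"
          using elim g_bdd G' p ab by (intro sum_mono mult_mono) (auto simp: P_def intro: order.trans)
        finally show "h N p \<le> \<epsilon> N" by (simp add: \<epsilon>_def)
      qed
    qed
    show "eventually (\<lambda>N. (\<Sum>p\<in>P N. (h N p)\<^sup>2 / real p * (1 - 1 / real p)) = 1) sequentially"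
      using DB
    proof eventually_elim
      case (elim N)
      have "(\<Sum>p\<in>P N. (h N p)\<^sup>2 / real p * (1 - 1 / real p))
          = (\<Sum>p\<in>P N. (\<Sum>i<l. D N i * g i p)\<^sup>2 / real p * (1 - 1 / real p)) / (B N)\<^sup>2"
        by (subst sum_divide_distrib, intro sum.cong refl) (simp add: h_def power_divide)
      also have "(\<Sum>p\<in>P N. (\<Sum>i<l. D N i * g i p)\<^sup>2 / real p * (1 - 1 / real p)) = (B N)\<^sup>2"
        unfolding B_def D_def m_def P_def by (rule B_Q_squared[OF Q_nonneg g0, symmetric])
      finally show ?case using elim by simp
    qed
    show "eventually (\<lambda>N. (\<Sum>p\<in>P N. h N p / real p) \<le> C / \<epsilon> N) sequentially"
      using DB mu_v v_gt[of 0]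
    proof eventually_elim
      case (elim N)
      have "(\<Sum>i<l. D N i / B N * m N i) \<le> (\<Sum>i<l. 1 / sqrt (a * v N) * (b * v N))"
        using elim m0 ab by (intro sum_mono mult_mono) (auto simp: m_def)
      also have "\<dots> = C / \<epsilon> N"
      proof -
        have "sqrt (a * v N) * sqrt (a * v N) = a * v N" using elim ab by simp
        thus ?thesis using elim ab G' l by (simp add: C_def \<epsilon>_def field_simps power2_eq_square)
      qed
      finally show ?case by (simp add: mean_h)
    qed
  qed

  \<comment> \<open>\<open>Y\<close> is the normalized polynomial and \<open>X\<close> its linear
    part at the means, written through primes so that \<open>char_h\<close> applies to it.\<close>
  define X where "X = (\<lambda>N n. (\<Sum>p\<in>P N. if p dvd n then h N p else 0) - (\<Sum>p\<in>P N. h N p / real p))"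
  define Y where "Y = (\<lambda>N n. (mpoly_eval l Q (\<lambda>i. g i n) - A_Q l Q g (real N)) / B N)"
  have X: "X N n = (\<Sum>i<l. D N i * (g i n - m N i)) / B N" if n: "n \<in> {1..N}" for N n
  proof -
    have "(\<Sum>p\<in>P N. if p dvd n then h N p else 0) = (\<Sum>p\<in>P N. \<Sum>i<l. D N i / B N * (if p dvd n then g i p else 0))"
      by (intro sum.cong refl) (auto simp: h_def sum_divide_distrib)
    also have "\<dots> = (\<Sum>i<l. \<Sum>p\<in>P N. D N i / B N * (if p dvd n then g i p else 0))" by (rule sum.swap)
    also have "\<dots> = (\<Sum>i<l. D N i / B N * g i n)"
    proof (intro sum.cong refl)
      fix i assume "i \<in> {..<l}"
      hence "g i n = (\<Sum>p\<in>P N. if p dvd n then g i p else 0)"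
        unfolding P by (intro strongly_additive_eq_sum_primes[OF g_sadd n]) auto
      thus "(\<Sum>p\<in>P N. D N i / B N * (if p dvd n then g i p else 0)) = D N i / B N * g i n"
        by (simp only: sum_distrib_left)
    qed
    finally show ?thesis unfolding X_def mean_h sum_divide_distrib sum_subtractf [symmetric]
      by (simp only: sum_subtractf [symmetric] right_diff_distrib diff_divide_distrib times_divide_eq_left)
  qed

  obtain T where T: "T \<ge> 0" "\<And>t y \<tau>. (\<forall>i<l. t i \<ge> 0 \<and> \<bar>y i\<bar> \<le> \<tau>) \<Longrightarrow> 0 \<le> \<tau> \<Longrightarrow> \<tau> \<le> 1 \<Longrightarrow>
     \<bar>mpoly_eval l Q (\<lambda>i. t i * (1 + y i)) - mpoly_eval l Q t
        - (\<Sum>i<l. mpoly_deriv_eval l Q i t * (t i * y i))\<bar>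
     \<le> T * \<tau>\<^sup>2 * (\<Sum>i<l. t i * mpoly_deriv_eval l Q i t)"
    using mpoly_eval_first_order[OF Q_finite Q_nonneg, of l] by blast

  have close: "eventually (\<lambda>N. \<forall>n\<in>{1..N}. (\<forall>i<l. \<bar>g i n - m N i\<bar> \<le> K * sqrt (v N)) \<longrightarrow> \<bar>X N n - Y N n\<bar> \<le> \<delta>) sequentially"
    if \<delta>: "\<delta> > 0" and K: "K > 0" for \<delta> K :: real
  proof -
    \<comment> \<open>With relative deviations \<open>\<tau> = K / (a * sqrt (v N))\<close>, the
      remainder \<open>T * \<tau>\<^sup>2\<close> times a sum of order \<open>sqrt (v N)\<close>
      equals \<open>M / sqrt (v N)\<close>. The two thresholds for \<open>v N\<close> ensure
      \<open>\<tau> \<le> 1\<close> and a remainder of at most \<open>\<delta>\<close>.\<close>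
    define M where "M = T * (K / a)\<^sup>2 * (real l * b / sqrt a)"
    have v_large: "eventually (\<lambda>N. v N > (K / a)\<^sup>2 \<and> v N > (M / \<delta>)\<^sup>2) sequentially"
      by (intro eventually_conj v_gt)
    show ?thesis using DB mu_v v_large v_gt[of 0]
    proof eventually_elim
      case (elim N)
      define s where "s = sqrt (v N)"
      have s: "s > 0" "s\<^sup>2 = v N" using elim by (auto simp: s_def)
      have sK: "K / a < s" "M / \<delta> < s"
        unfolding s_def using elim by (auto intro!: real_less_rsqrt)
      define \<tau> where "\<tau> = K / (a * s)"
      have \<tau>: "0 \<le> \<tau>" "\<tau> \<le> 1" using K ab s sK by (auto simp: \<tau>_def field_simps)
      show ?case
      proof (intro ballI impI)
        fix n assume n: "n \<in> {1..N}" and dev: "\<forall>i<l. \<bar>g i n - m N i\<bar> \<le> K * sqrt (v N)"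
        define y where "y = (\<lambda>i. (g i n - m N i) / m N i)"
        have mpos: "m N i \<ge> a * s\<^sup>2" "m N i > 0" if "i < l" for i
        proof -
          show "m N i \<ge> a * s\<^sup>2" using elim that by (auto simp: m_def s)
          moreover have "a * s\<^sup>2 > 0" using ab s(1) by simp
          ultimately show "m N i > 0" by linarith
        qed
        have y: "\<bar>y i\<bar> \<le> \<tau>" if i: "i < l" for i
        proof -
          have "\<bar>y i\<bar> = \<bar>g i n - m N i\<bar> / m N i" using mpos[OF i] by (simp add: y_def)
          also have "\<dots> \<le> K * s / (a * s\<^sup>2)"
            using dev i mpos[OF i] ab s K by (intro frac_le) (auto simp: s_def)
          also have "\<dots> = \<tau>" using s(1) by (simp add: \<tau>_def power2_eq_square)
          finally show ?thesis .
        qed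
        have my: "m N i * (1 + y i) = g i n" "m N i * y i = g i n - m N i" if "i < l" for i
          using mpos[OF that] by (auto simp: y_def field_simps)
        have ev: "mpoly_eval l Q (\<lambda>i. m N i * (1 + y i)) = mpoly_eval l Q (\<lambda>i. g i n)"
          unfolding mpoly_eval_def by (intro sum.cong refl arg_cong2[where f = "(*)"] prod.cong) (auto simp: my)
        have "\<bar>mpoly_eval l Q (\<lambda>i. m N i * (1 + y i)) - mpoly_eval l Q (m N)
            - (\<Sum>i<l. D N i * (m N i * y i))\<bar> \<le> T * \<tau>\<^sup>2 * (\<Sum>i<l. m N i * D N i)"
          unfolding D_def using m0 y \<tau> by (intro T(2)) auto
        also have "(\<Sum>i<l. D N i * (m N i * y i)) = (\<Sum>i<l. D N i * (g i n - m N i))"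
          by (intro sum.cong refl) (simp add: my)
        finally have "\<bar>mpoly_eval l Q (\<lambda>i. g i n) - A_Q l Q g (real N) - (\<Sum>i<l. D N i * (g i n - m N i))\<bar>
            \<le> T * \<tau>\<^sup>2 * (\<Sum>i<l. m N i * D N i)"
          unfolding ev by (simp add: A_Q_def m_def)
        hence "\<bar>mpoly_eval l Q (\<lambda>i. g i n) - A_Q l Q g (real N) - (\<Sum>i<l. D N i * (g i n - m N i))\<bar> / B N
            \<le> T * \<tau>\<^sup>2 * (\<Sum>i<l. m N i * D N i) / B N"
          using elim by (intro divide_right_mono) auto
        also have "\<bar>mpoly_eval l Q (\<lambda>i. g i n) - A_Q l Q g (real N) - (\<Sum>i<l. D N i * (g i n - m N i))\<bar> / B N
            = \<bar>X N n - Y N n\<bar>"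
        proof -
          have "X N n - Y N n = - ((mpoly_eval l Q (\<lambda>i. g i n) - A_Q l Q g (real N) - (\<Sum>i<l. D N i * (g i n - m N i))) / B N)"
            unfolding X[OF n] Y_def by (simp add: diff_divide_distrib)
          thus ?thesis using elim by (simp add: abs_divide)
        qed
        also have "T * \<tau>\<^sup>2 * (\<Sum>i<l. m N i * D N i) / B N = T * \<tau>\<^sup>2 * (\<Sum>i<l. m N i * (D N i / B N))"
          by (simp only: times_divide_eq_right sum_divide_distrib [symmetric])
        also have "\<dots> \<le> T * \<tau>\<^sup>2 * (\<Sum>i<l. (b * v N) * (1 / sqrt (a * v N)))"
          using elim m0 D0 ab T(1) by (intro mult_left_mono sum_mono mult_mono) (auto simp: m_def)
        also have "\<dots> = M / s"
        proof -
          have "sqrt (a * v N) = sqrt a * s" by (simp add: real_sqrt_mult s_def)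
          thus ?thesis using s(1) ab by (simp add: M_def \<tau>_def s(2)[symmetric] field_simps power2_eq_square)
        qed
        also have "\<dots> \<le> \<delta>" using sK(2) s(1) \<delta> by (simp add: field_simps)
        finally show "\<bar>X N n - Y N n\<bar> \<le> \<delta>" .
      qed
    qed
  qed

  have diff: "(\<lambda>N. real (card {n\<in>{1..N}. \<bar>X N n - Y N n\<bar> > \<delta>}) / real N) \<longlonglongrightarrow> 0" if \<delta>: "\<delta> > 0" for \<delta>
  proof (rule tendstoI)
    fix \<eta> :: real assume \<eta>: "\<eta> > 0"
    \<comment> \<open>Chosen so that the \<open>l\<close> Chebyshev bounds add up to less than
      \<open>\<eta>\<close>; the summand 1 makes \<open>K\<close> positive and the inequality
      strict.\<close>
    define K where "K = sqrt (real l * 3 * G' * b / \<eta>) + 1"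
    have K: "K > 0" unfolding K_def using l G' ab \<eta> by (intro add_nonneg_pos) auto
    have K2: "real l * (3 * G' * b / K\<^sup>2) < \<eta>"
    proof -
      have "real l * 3 * G' * b / \<eta> = (sqrt (real l * 3 * G' * b / \<eta>))\<^sup>2"
        using l G' ab \<eta> by simp
      also have "\<dots> < K\<^sup>2" unfolding K_def using l G' ab \<eta> by (intro power_strict_mono) auto
      finally show ?thesis using K \<eta> by (simp add: field_simps)
    qed
    show "eventually (\<lambda>N. dist (real (card {n\<in>{1..N}. \<bar>X N n - Y N n\<bar> > \<delta>}) / real N) 0 < \<eta>) sequentially"
      using close[OF \<delta> K] mu_v v_gt[of 0] eventually_gt_at_top[of 0]
    proof eventually_elim
      case (elim N)
      define R where "R = K * sqrt (v N)"
      have R: "R > 0" "R\<^sup>2 = K\<^sup>2 * v N" using K elim by (auto simp: R_def power_mult_distrib)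
      define E where "E = (\<lambda>i. {n\<in>{1..N}. \<bar>g i n - m N i\<bar> > R})"
      have E: "real (card (E i)) \<le> 3 * G' * b / K\<^sup>2 * real N" if i: "i < l" for i
      proof -
        have "real (card (E i)) \<le> 3 * G' * m N i / R\<^sup>2 * real N"
          unfolding E_def m_def using g_bdd[OF i] G' 
          by (intro deviation_probability_le g_sadd[OF i] R) (auto intro: order.trans)
        also have "\<dots> \<le> 3 * G' * (b * v N) / R\<^sup>2 * real N"
          using elim i G' by (intro mult_right_mono divide_right_mono mult_left_mono) (auto simp: m_def)
        also have "\<dots> = 3 * G' * b / K\<^sup>2 * real N" using elim K by (simp add: R)
        finally show ?thesis .
      qed
      have "card {n\<in>{1..N}. \<bar>X N n - Y N n\<bar> > \<delta>} \<le> card (\<Union>i<l. E i)"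
        using elim(1) by (intro card_mono) (force simp: E_def R_def not_le[symmetric])+
      also have "\<dots> \<le> (\<Sum>i<l. card (E i))" by (rule card_UN_le) auto
      finally have "real (card {n\<in>{1..N}. \<bar>X N n - Y N n\<bar> > \<delta>}) \<le> (\<Sum>i<l. real (card (E i)))"
        by (simp flip: of_nat_sum)
      also have "\<dots> \<le> (\<Sum>i<l. 3 * G' * b / K\<^sup>2 * real N)" by (intro sum_mono E) auto
      also have "\<dots> = real l * (3 * G' * b / K\<^sup>2) * real N" by simp
      also have "\<dots> < \<eta> * real N" using K2 elim by (intro mult_strict_right_mono) auto
      finally show ?case using elim by (simp add: divide_less_eq)
    qed
  qed

  have "(\<lambda>N. (\<Sum>n=1..N. iexp (t * Y N n)) / of_nat N) \<longlonglongrightarrow> of_real (exp (- t\<^sup>2 / 2))" for t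
    by (rule mean_iexp_tendsto_cong_prob[OF _ diff]) (use char_h in \<open>simp_all add: X_def\<close>)
  from normal_limit_of_mean_iexp[OF this, of u]
  show ?thesis
  proof (rule Lim_transform_eventually)
    show "eventually (\<lambda>N. real (card {n\<in>{1..N}. Y N n < u}) / real N =
        real (card {n\<in>{1..N}. mpoly_eval l Q (\<lambda>i. g i n) < A_Q l Q g (real N) + u * B_Q l Q g (real N)}) / real N) sequentially"
      using DB
    proof eventually_elim
      case (elim N)
      hence "Y N n < u \<longleftrightarrow> mpoly_eval l Q (\<lambda>i. g i n) < A_Q l Q g (real N) + u * B_Q l Q g (real N)" for n
        by (auto simp: Y_def B_def divide_less_eq)
      thus ?case by simp
    qed
  qed
qed

section \<open>From integers N to the real parameter x\<close>

lemma real_primes_le_floor: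
  assumes "x \<ge> 0"
  shows "{p. prime p \<and> real p \<le> x} = {p. prime p \<and> real p \<le> real (nat \<lfloor>x\<rfloor>)}"
proof -
  have "real p \<le> x \<longleftrightarrow> p \<le> nat \<lfloor>x\<rfloor>" for p
    using assms by (simp add: le_nat_iff le_floor_iff)
  thus ?thesis by simp
qed

lemma A_B_Q_floor:
  assumes "x \<ge> 0"
  shows "A_Q l Q g x = A_Q l Q g (real (nat \<lfloor>x\<rfloor>))" "B_Q l Q g x = B_Q l Q g (real (nat \<lfloor>x\<rfloor>))"
proof -
  have "mu f x = mu f (real (nat \<lfloor>x\<rfloor>))" "kappa f h x = kappa f h (real (nat \<lfloor>x\<rfloor>))" for f h
    unfolding mu_def kappa_def real_primes_le_floor[OF assms] by (rule refl)+
  thus "A_Q l Q g x = A_Q l Q g (real (nat \<lfloor>x\<rfloor>))" "B_Q l Q g x = B_Q l Q g (real (nat \<lfloor>x\<rfloor>))"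
    by (simp_all only: A_Q_def B_Q_def)
qed

text \<open>For a polynomial constant in its \<open>l\<close> variables, \<open>B_Q\<close> vanishes
  and no \<open>n\<close> is counted, so the limit would be 0; \<open>Q_nonconst\<close> excludes
  this. It asks for a positive exponent at an index below \<open>l\<close>, because exponents at
  other indices do not affect \<open>mpoly_eval\<close>.\<close>

theorem mainTheorem1:
  fixes l :: nat and Q :: "(nat \<Rightarrow> nat) \<Rightarrow> real" and g :: "nat \<Rightarrow> nat \<Rightarrow> real" and u :: real
  assumes Q_finite: "finite {\<alpha>. Q \<alpha> \<noteq> 0}"
    and Q_nonneg: "\<forall>\<alpha>. Q \<alpha> \<ge> 0"
    and Q_nonconst: "\<exists>\<alpha>. Q \<alpha> \<noteq> 0 \<and> (\<exists>i<l. \<alpha> i > 0)"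
    and g_sadd: "\<forall>j<l. strongly_additive (g j)"
    and g_nonneg: "\<forall>j<l. \<forall>n. g j n \<ge> 0"
    and g_bdd: "\<forall>j<l. \<exists>G. \<forall>p. prime p \<longrightarrow> g j p \<le> G"
    and g_div: "\<forall>j<l. \<not> summable (\<lambda>p. if prime p then (g j p)\<^sup>2 / real p else 0)"
    and g_var: "\<forall>i<l. \<forall>j<l. \<exists>c>0. eventually (\<lambda>x. sigma2 (g i) x \<ge> c * mu (g j) x) at_top"
  shows "((\<lambda>x. real (card {n \<in> {1..nat \<lfloor>x\<rfloor>}.
             mpoly_eval l Q (\<lambda>i. g i n) < A_Q l Q g x + u * B_Q l Q g x}) / x)
          \<longlongrightarrow> (1 / sqrt (2 * pi)) * (LBINT t:{..u}. exp (- t\<^sup>2 / 2))) at_top"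
proof -
  obtain \<beta> i\<^sub>0 where \<beta>: "Q \<beta> \<noteq> 0" "i\<^sub>0 < l" "\<beta> i\<^sub>0 > 0" using Q_nonconst by blast
  hence l: "0 < l" by simp
  from g_bdd obtain H where H: "\<And>j p. j < l \<Longrightarrow> prime p \<Longrightarrow> g j p \<le> H j" by metis
  have H0: "H j \<ge> 0" if "j < l" for j
    using H[OF that two_is_prime_nat] g_nonneg that by (meson order.trans)
  define G where "G = (\<Sum>j<l. H j) + 1"
  have G: "G > 0" unfolding G_def using H0 by (intro add_nonneg_pos sum_nonneg) auto
  have gG: "0 \<le> g j p \<and> g j p \<le> G" if "j < l" "prime p" for j p
  proof -
    have "H j \<le> (\<Sum>j<l. H j)" using that H0 by (intro member_le_sum) auto
    thus ?thesis using H[OF that] g_nonneg that by (fastforce simp: G_def)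
  qed
  from g_var obtain c' where c': "\<And>i j. i < l \<Longrightarrow> j < l \<Longrightarrow> c' i j > 0"
    "\<And>i j. i < l \<Longrightarrow> j < l \<Longrightarrow> eventually (\<lambda>x. sigma2 (g i) x \<ge> c' i j * mu (g j) x) at_top" by metis
  define c where "c = Min ((\<lambda>(i, j). c' i j) ` ({..<l} \<times> {..<l}))"
  have c: "c > 0" unfolding c_def using c' l by (subst Min_gr_iff) auto
  have cc': "c \<le> c' i j" if "i < l" "j < l" for i j
    unfolding c_def by (rule Min_le) (use that in force)+
  have mu0: "mu (g j) x \<ge> 0" if "j < l" for j x
    using gG that by (intro mu_nonneg) auto
  have sigma2_ge: "eventually (\<lambda>N. \<forall>i\<in>{..<l}. \<forall>j\<in>{..<l}. c * mu (g j) (real N) \<le> sigma2 (g i) (real N)) sequentially"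
  proof (intro eventually_ball_finite ballI finite_lessThan)
    fix i j assume ij: "i \<in> {..<l}" "j \<in> {..<l}"
    hence "eventually (\<lambda>N. sigma2 (g i) (real N) \<ge> c' i j * mu (g j) (real N)) sequentially"
      using eventually_compose_filterlim[OF c'(2) filterlim_real_sequentially] by simp
    thus "eventually (\<lambda>N. c * mu (g j) (real N) \<le> sigma2 (g i) (real N)) sequentially"
    proof eventually_elim
      case (elim N)
      have "c * mu (g j) (real N) \<le> c' i j * mu (g j) (real N)"
        using cc' mu0 ij by (intro mult_right_mono) auto
      with elim show ?case by linarith
    qed
  qed
  have sigma2_le: "sigma2 (g j) x \<le> G * mu (g j) x" if "j < l" for j x
    using gG[OF that] by (intro sigma2_le_mu) auto
  \<comment> \<open>Any one of the means can serve as the common scale. From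
    \<open>c * mu (g j) \<le> sigma2 (g i)\<close> and
    \<open>sigma2 (g i) \<le> G * mu (g i)\<close>, used with one of the indices equal to 0, every
    mean lies between \<open>c / G * v\<close> and \<open>G / c * v\<close>, and every variance is
    at least \<open>c * v\<close>.\<close>
  define v where "v = (\<lambda>N. mu (g 0) (real N))"
  define a where "a = min c (c / G)"
  have a: "a > 0" using c G by (simp add: a_def)
  have v0: "v N \<ge> 0" for N unfolding v_def using mu0[OF l] .
  have av: "a * v N \<le> c * v N" "a * v N \<le> c / G * v N" for N
    unfolding a_def by (rule mult_right_mono[OF min.cobounded1 v0], rule mult_right_mono[OF min.cobounded2 v0])
  have v: "filterlim v at_top sequentially"
  proof (rule filterlim_at_top_mono)
    have "filterlim (\<lambda>N. sigma2 (g 0) (real N)) at_top sequentially"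
      using g_div l by (intro sigma2_at_top) auto
    thus "filterlim (\<lambda>N. 1 / G * sigma2 (g 0) (real N)) at_top sequentially"
      using G by (intro filterlim_tendsto_pos_mult_at_top[OF tendsto_const]) auto
    show "eventually (\<lambda>N. 1 / G * sigma2 (g 0) (real N) \<le> v N) sequentially"
      using sigma2_le[OF l] G by (auto simp: v_def field_simps)
  qed
  define F where "F = (\<lambda>N. real (card {n\<in>{1..N}. mpoly_eval l Q (\<lambda>i. g i n)
      < A_Q l Q g (real N) + u * B_Q l Q g (real N)}) / real N)"
  have "F \<longlonglongrightarrow> 1 / sqrt (2 * pi) * (LBINT t:{..u}. exp (- t\<^sup>2 / 2))"
    unfolding F_def
  proof (rule polynomial_erdos_kac_nat[where G = G and v = v and a = a and b = "G / c", OF Q_finite _ \<beta>])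
    show "eventually (\<lambda>N. \<forall>j<l. a * v N \<le> mu (g j) (real N) \<and> mu (g j) (real N) \<le> G / c * v N) sequentially"
      using sigma2_ge
    proof eventually_elim
      case (elim N)
      show ?case
      proof (intro allI impI conjI)
        fix j assume j: "j < l"
        have "c * v N \<le> G * mu (g j) (real N)"
          using elim l j sigma2_le[OF j, of "real N"] unfolding v_def by (meson lessThan_iff order.trans)
        hence "c / G * v N \<le> mu (g j) (real N)" using G by (simp add: field_simps)
        thus "a * v N \<le> mu (g j) (real N)" using av(2)[of N] by linarith
        have "c * mu (g j) (real N) \<le> G * v N"
          using elim l j sigma2_le[OF l, of "real N"] unfolding v_def by (meson lessThan_iff order.trans)
        thus "mu (g j) (real N) \<le> G / c * v N" using c by (simp add: field_simps)
      qed
    qed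
    show "eventually (\<lambda>N. \<forall>j<l. a * v N \<le> sigma2 (g j) (real N)) sequentially"
      using sigma2_ge
    proof eventually_elim
      case (elim N)
      thus ?case using l av(1)[of N] unfolding v_def by (meson lessThan_iff order.trans)
    qed
  qed (use Q_nonneg g_sadd gG v a c G in auto)
  moreover have nat_floor: "filterlim (\<lambda>x::real. nat \<lfloor>x\<rfloor>) sequentially at_top"
    by (rule filterlim_compose[OF filterlim_nat_sequentially filterlim_floor_sequentially])
  ultimately have "((\<lambda>x::real. F (nat \<lfloor>x\<rfloor>)) \<longlongrightarrow> 1 / sqrt (2 * pi) * (LBINT t:{..u}. exp (- t\<^sup>2 / 2))) at_top"
    by (rule filterlim_compose)
  \<comment> \<open>The count depends on \<open>x\<close> only through its integer part, but it is
    divided by \<open>x\<close>; this ratio corrects the normalization.\<close>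
  moreover have "((\<lambda>x::real. real (nat \<lfloor>x\<rfloor>) / x) \<longlongrightarrow> 1) at_top" by real_asymp
  ultimately have "((\<lambda>x. F (nat \<lfloor>x\<rfloor>) * (real (nat \<lfloor>x\<rfloor>) / x))
      \<longlongrightarrow> 1 / sqrt (2 * pi) * (LBINT t:{..u}. exp (- t\<^sup>2 / 2)) * 1) at_top"
    by (rule tendsto_mult)
  thus ?thesis unfolding mult_1_right
  proof (rule Lim_transform_eventually)
    show "eventually (\<lambda>x. F (nat \<lfloor>x\<rfloor>) * (real (nat \<lfloor>x\<rfloor>) / x) = real (card {n \<in> {1..nat \<lfloor>x\<rfloor>}.
             mpoly_eval l Q (\<lambda>i. g i n) < A_Q l Q g x + u * B_Q l Q g x}) / x) at_top"
      using eventually_ge_at_top[of 1]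
    proof eventually_elim
      case (elim x)
      have "nat \<lfloor>x\<rfloor> \<ge> 1" using elim by (intro le_nat_floor) simp
      hence "real (nat \<lfloor>x\<rfloor>) \<ge> 1" by (simp only: real_of_nat_ge_one_iff)
      moreover have "c / r * (r / x) = c / x" if "r \<ge> 1" for c r :: real using that by simp
      moreover have "0 \<le> x" using elim by simp
      note AB = A_B_Q_floor[OF this, of l Q g]
      have "F (nat \<lfloor>x\<rfloor>) = real (card {n \<in> {1..nat \<lfloor>x\<rfloor>}.
          mpoly_eval l Q (\<lambda>i. g i n) < A_Q l Q g x + u * B_Q l Q g x}) / real (nat \<lfloor>x\<rfloor>)"
        unfolding F_def AB ..
      ultimately show ?case by (simp only:)
    qed
  qed
qed

end
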